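(* Let $f:\mathbb{D}^2\to\mathbb{C}^{M\times N}$ be holomorphic with $\|f(z)\|\le1$ for all $z\in\mathbb{D}^2$. Then there exist positive semi-definite kernels $k_1,k_2:\mathbb{D}^2\times\mathbb{D}^2\to\mathbb{C}^{N\times N}$ such that for all $w,z\in\mathbb{D}^2$ $$I-f(w)^*f(z)=\sum_{j=1}^{2}(1-\bar w_jz_j)\,k_j(w,z).$$
   Context: $\mathbb{D}^2$ is the unit bidisk in $\mathbb{C}^2$; matrix norms are operator norms. For a set $X$, a function $K:X\times X\to\mathbb{C}^{N\times N}$ is a positive semi-definite kernel if for all $n$, all $x_1,\dots,x_n\in X$ and $v_1,\dots,v_n\in\mathbb{C}^N$ one has $\sum_{i,j}\langle K(x_i,x_j)v_j,v_i\rangle\ge0$. *)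

theory Defs
  imports "HOL-Analysis.Analysis"
begin

definition bidisk :: "(complex ^ 2) set" where
  "bidisk = {z. \<forall>j. norm (z $ j) < 1}"

text \<open>The scalar multiplications of the library on \<open>complex ^ 'n ^ 'm\<close> are by reals or by row vectors;
  this one is by complex numbers.\<close>

definition cscale_mat :: "complex \<Rightarrow> complex ^ 'n ^ 'm \<Rightarrow> complex ^ 'n ^ 'm" where
  "cscale_mat c A = map_matrix (\<lambda>x. c * x) A"

definition conj_transpose :: "complex ^ 'n ^ 'm \<Rightarrow> complex ^ 'm ^ 'n" where
  "conj_transpose A = map_matrix cnj (transpose A)"

text \<open>The library's inner product on \<open>complex ^ 'n\<close> is real-valued; this is the Hermitian one,
  linear in the first argument.\<close>

definition cinner_vec :: "complex ^ 'n \<Rightarrow> complex ^ 'n \<Rightarrow> complex" where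
  "cinner_vec u v = (\<Sum>i\<in>UNIV. u $ i * cnj (v $ i))"

text \<open>Holomorphy in several variables: the real Frechet derivative exists and is complex linear
  (its additivity is part of \<open>has_derivative\<close>).\<close>

definition holomorphic_mat_on :: "(complex ^ 'd \<Rightarrow> complex ^ 'n ^ 'm) \<Rightarrow> (complex ^ 'd) set \<Rightarrow> bool" where
  "holomorphic_mat_on f S \<longleftrightarrow>
     (\<forall>z\<in>S. \<exists>D. (f has_derivative D) (at z within S) \<and> (\<forall>c h. D (c *s h) = cscale_mat c (D h)))"

definition psd_kernel_on :: "'x set \<Rightarrow> ('x \<Rightarrow> 'x \<Rightarrow> complex ^ 'n ^ 'n) \<Rightarrow> bool" where
  "psd_kernel_on X K \<longleftrightarrow>
     (\<forall>(n::nat) (x :: nat \<Rightarrow> 'x) (v :: nat \<Rightarrow> complex ^ 'n).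
        (\<forall>i<n. x i \<in> X) \<longrightarrow>
        (\<Sum>i<n. \<Sum>j<n. cinner_vec (K (x i) (x j) *v v j) (v i)) \<in> \<real>\<^sub>\<ge>\<^sub>0)"

end

theory Submission
  imports Defs "HOL-Complex_Analysis.Complex_Analysis"
begin

text \<open>
Write \<open>f z = \<Sum>\<alpha>. c \<alpha> * z\<^sup>\<alpha>\<close>, with \<open>c \<alpha> = 0\<close> outside the quadrant of nonnegative indices. On
finitely supported vector sequences \<open>u\<close> over the lattice of integer pairs consider the Toeplitz
operator \<open>(T u) \<alpha> = \<Sum>\<gamma>. c (\<gamma> - \<alpha>) (u \<gamma>)\<close>. On the Fourier side it is multiplication by
the values of \<open>f\<close> at conjugate points of the torus, so \<open>\<parallel>f\<parallel> \<le> 1\<close> makes it a contraction for the square-sum norm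
(\<open>toeplitz_contractive\<close>; a discrete Fourier transform and two limits).

Positive quadratic forms \<open>k\<close> on sequences over the quadrant, with coefficients \<open>\<kappa> \<alpha> \<beta>\<close>, give positive
kernels \<open>\<Sum>\<alpha> \<beta>. \<kappa> \<alpha> \<beta> * cnj (w\<^sup>\<alpha>) * z\<^sup>\<beta>\<close>, and multiplying the kernel by \<open>cnj (w $ j) * z $ j\<close>
amounts to composing the form with the backward shift \<open>\<sigma>\<^sub>j\<close>. Comparing coefficients, the theorem
asks for positive forms \<open>k\<^sub>1\<close>, \<open>k\<^sub>2\<close> with
\<open>k\<^sub>1 x - k\<^sub>1 (\<sigma>\<^sub>1 x) + k\<^sub>2 x - k\<^sub>2 (\<sigma>\<^sub>2 x) = |x 0|\<^sup>2 - |(T x) 0|\<^sup>2\<close>.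

They are obtained by a minimisation. On sequences supported in the half plane \<open>i \<ge> 0\<close>, the defect
\<open>q u = \<parallel>u\<parallel>\<^sup>2 - \<parallel>T u\<parallel>\<^sup>2\<close>, where \<open>T u\<close> is measured on the half plane only, is a positive form. Let \<open>a x\<close> be the
infimum of \<open>q u\<close> over all such \<open>u\<close> that agree with \<open>x\<close> on the quadrant (the shorted form of Krein
and of Anderson and Trapp). An infimum of this kind inherits the parallelogram law, so it is again a
quadratic form, by the theorem of Jordan and von Neumann.

The defect is invariant under vertical shifts. A vertical backward shift sends competitors
for \<open>a x\<close> to competitors for \<open>a (\<sigma>\<^sub>2 x)\<close>, hence \<open>k\<^sub>1 x = a x - a (\<sigma>\<^sub>2 x) \<ge> 0\<close>. In the horizontal
direction, move a competitor for \<open>a (\<sigma>\<^sub>1 x)\<close> one step to the right and put \<open>x\<close> on the ray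
\<open>i = 0, j \<ge> 0\<close>. The result competes for \<open>a x\<close>. As \<open>T\<close> only looks up and to the right,
this raises the defect by at most \<open>r x = |x|\<^sup>2 - |T x|\<^sup>2\<close>, both measured on the ray, hence
\<open>k\<^sub>2 x = r x - a x + a (\<sigma>\<^sub>1 x) \<ge> 0\<close> (\<open>shorted_le_ray_defect\<close>). When \<open>k\<^sub>1\<close> and \<open>k\<^sub>2\<close> are inserted into the required
identity, all terms with \<open>a\<close> cancel and \<open>r x - r (\<sigma>\<^sub>2 x)\<close> is left, which is the right-hand side.
\<close>

section \<open>Quadratic forms on finitely supported families\<close>

definition finsupp :: "('i \<Rightarrow> complex) \<Rightarrow> bool" where
  "finsupp u \<longleftrightarrow> finite {p. u p \<noteq> 0}"

lemma finsupp_superset: "finite S \<Longrightarrow> (\<And>p. p \<notin> S \<Longrightarrow> u p = 0) \<Longrightarrow> finsupp u"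
  unfolding finsupp_def by (rule finite_subset[of _ S]) auto

lemma finsupp_add [simp]: "finsupp u \<Longrightarrow> finsupp v \<Longrightarrow> finsupp (\<lambda>p. u p + v p)"
  by (rule finsupp_superset[of "{p. u p \<noteq> 0} \<union> {p. v p \<noteq> 0}"]) (auto simp: finsupp_def)

lemma finsupp_diff [simp]: "finsupp u \<Longrightarrow> finsupp v \<Longrightarrow> finsupp (\<lambda>p. u p - v p)"
  by (rule finsupp_superset[of "{p. u p \<noteq> 0} \<union> {p. v p \<noteq> 0}"]) (auto simp: finsupp_def)

lemma finsupp_scale [simp]: "finsupp u \<Longrightarrow> finsupp (\<lambda>p. c * u p)"
  by (rule finsupp_superset[of "{p. u p \<noteq> 0}"]) (auto simp: finsupp_def)

lemma finsupp_zero [simp]: "finsupp (\<lambda>p. 0)"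
  by (simp add: finsupp_def)

lemma finsupp_restrict [simp]: "finsupp u \<Longrightarrow> finsupp (\<lambda>p. if P p then u p else 0)"
  by (rule finsupp_superset[of "{p. u p \<noteq> 0}"]) (auto simp: finsupp_def)

definition unit_at :: "'i \<Rightarrow> 'i \<Rightarrow> complex" where
  "unit_at p = (\<lambda>r. if r = p then 1 else 0)"

lemma finsupp_unit_at [simp]: "finsupp (unit_at p)"
  by (rule finsupp_superset[of "{p}"]) (auto simp: unit_at_def)

text \<open>
Forms are described by the parallelogram law and not by a sesquilinear kernel, because the
parallelogram law survives the infimum taken in the definition of the shorted form.
\<close>

definition quadratic_form :: "(('i \<Rightarrow> complex) \<Rightarrow> real) \<Rightarrow> bool" where
  "quadratic_form a \<longleftrightarrow>
     (\<forall>u v. finsupp u \<longrightarrow> finsupp v \<longrightarrow>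
        a (\<lambda>p. u p + v p) + a (\<lambda>p. u p - v p) = 2 * a u + 2 * a v) \<and>
     (\<forall>c u. finsupp u \<longrightarrow> a (\<lambda>p. c * u p) = (cmod c)\<^sup>2 * a u)"

definition real_polar :: "(('i \<Rightarrow> complex) \<Rightarrow> real) \<Rightarrow> ('i \<Rightarrow> complex) \<Rightarrow> ('i \<Rightarrow> complex) \<Rightarrow> real" where
  "real_polar a u v = (a (\<lambda>p. u p + v p) - a (\<lambda>p. u p - v p)) / 4"

text \<open>
The convention is linearity in the first argument, which fixes the sign of the imaginary part.
\<close>

definition polar :: "(('i \<Rightarrow> complex) \<Rightarrow> real) \<Rightarrow> ('i \<Rightarrow> complex) \<Rightarrow> ('i \<Rightarrow> complex) \<Rightarrow> complex" where
  "polar a u v = Complex (real_polar a u v) (real_polar a u (\<lambda>p. \<i> * v p))"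

lemma quadratic_formI:
  assumes "\<And>u v. finsupp u \<Longrightarrow> finsupp v \<Longrightarrow>
        a (\<lambda>p. u p + v p) + a (\<lambda>p. u p - v p) = 2 * a u + 2 * a v"
    and "\<And>c u. finsupp u \<Longrightarrow> a (\<lambda>p. c * u p) = (cmod c)\<^sup>2 * a u"
  shows "quadratic_form a"
  using assms by (simp add: quadratic_form_def)

lemma quadratic_form_parallelogram:
  "quadratic_form a \<Longrightarrow> finsupp u \<Longrightarrow> finsupp v \<Longrightarrow>
     a (\<lambda>p. u p + v p) + a (\<lambda>p. u p - v p) = 2 * a u + 2 * a v"
  by (simp add: quadratic_form_def)

lemma quadratic_form_scale:
  "quadratic_form a \<Longrightarrow> finsupp u \<Longrightarrow> a (\<lambda>p. c * u p) = (cmod c)\<^sup>2 * a u"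
  by (simp add: quadratic_form_def)

lemma quadratic_form_zero: "quadratic_form a \<Longrightarrow> a (\<lambda>p. 0) = 0"
  using quadratic_form_scale[of a "\<lambda>p. 0" 0] by simp

lemma quadratic_form_add:
  assumes "quadratic_form a" "quadratic_form b"
  shows "quadratic_form (\<lambda>u. a u + b u)"
proof (rule quadratic_formI)
  fix u v :: "'a \<Rightarrow> complex" assume fin: "finsupp u" "finsupp v"
  show "a (\<lambda>p. u p + v p) + b (\<lambda>p. u p + v p) + (a (\<lambda>p. u p - v p) + b (\<lambda>p. u p - v p))
      = 2 * (a u + b u) + 2 * (a v + b v)"
    using quadratic_form_parallelogram[OF assms(1) fin] quadratic_form_parallelogram[OF assms(2) fin] by (simp add: algebra_simps)
qed (use assms in \<open>simp add: quadratic_form_scale algebra_simps\<close>)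

lemma quadratic_form_diff:
  assumes "quadratic_form a" "quadratic_form b"
  shows "quadratic_form (\<lambda>u. a u - b u)"
proof (rule quadratic_formI)
  fix u v :: "'a \<Rightarrow> complex" assume fin: "finsupp u" "finsupp v"
  show "a (\<lambda>p. u p + v p) - b (\<lambda>p. u p + v p) + (a (\<lambda>p. u p - v p) - b (\<lambda>p. u p - v p))
      = 2 * (a u - b u) + 2 * (a v - b v)"
    using quadratic_form_parallelogram[OF assms(1) fin] quadratic_form_parallelogram[OF assms(2) fin] by (simp add: algebra_simps)
qed (use assms in \<open>simp add: quadratic_form_scale algebra_simps\<close>)

context
  fixes a :: "('i \<Rightarrow> complex) \<Rightarrow> real"
  assumes quad: "quadratic_form a"
begin

lemma real_polar_zero: "finsupp v \<Longrightarrow> real_polar a (\<lambda>p. 0) v = 0"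
  using quadratic_form_scale[OF quad, of v "-1"] by (simp add: real_polar_def)

lemma real_polar_add_double:
  assumes "finsupp u" "finsupp u'" "finsupp v"
  shows "real_polar a u v + real_polar a u' v = real_polar a (\<lambda>p. u p + u' p) (\<lambda>p. 2 * v p) / 2"
proof -
  have 1: "a (\<lambda>p. (u p + v p) + (u' p + v p)) + a (\<lambda>p. (u p + v p) - (u' p + v p))
      = 2 * a (\<lambda>p. u p + v p) + 2 * a (\<lambda>p. u' p + v p)"
    using assms by (intro quadratic_form_parallelogram[OF quad]) auto
  have 2: "a (\<lambda>p. (u p - v p) + (u' p - v p)) + a (\<lambda>p. (u p - v p) - (u' p - v p))
      = 2 * a (\<lambda>p. u p - v p) + 2 * a (\<lambda>p. u' p - v p)"
    using assms by (intro quadratic_form_parallelogram[OF quad]) auto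
  have e: "(\<lambda>p. (u p + v p) + (u' p + v p)) = (\<lambda>p. u p + u' p + 2 * v p)"
    "(\<lambda>p. (u p - v p) + (u' p - v p)) = (\<lambda>p. u p + u' p - 2 * v p)"
    "(\<lambda>p. (u p + v p) - (u' p + v p)) = (\<lambda>p. u p - u' p)"
    "(\<lambda>p. (u p - v p) - (u' p - v p)) = (\<lambda>p. u p - u' p)"
    by (auto simp: algebra_simps)
  show ?thesis using 1 2 unfolding e real_polar_def by (simp add: field_simps)
qed

lemma real_polar_add:
  assumes "finsupp u" "finsupp u'" "finsupp v"
  shows "real_polar a (\<lambda>p. u p + u' p) v = real_polar a u v + real_polar a u' v"
proof -
  have "real_polar a w v = real_polar a w (\<lambda>p. 2 * v p) / 2" if "finsupp w" for w
    using real_polar_add_double[of w "\<lambda>p. 0" v] that assms real_polar_zero[of v] by simp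
  from this[of "\<lambda>p. u p + u' p"] show ?thesis
    using real_polar_add_double[OF assms] assms by simp
qed

lemma real_polar_commute:
  assumes "finsupp u" "finsupp v"
  shows "real_polar a u v = real_polar a v u"
  using quadratic_form_scale[OF quad, of "\<lambda>p. u p - v p" "-1"] assms
  by (simp add: real_polar_def add.commute)

lemma real_polar_rotate:
  assumes "finsupp u" "finsupp v"
  shows "real_polar a (\<lambda>p. \<i> * u p) (\<lambda>p. \<i> * v p) = real_polar a u v"
  using quadratic_form_scale[OF quad, of "\<lambda>p. u p - v p" \<i>]
    quadratic_form_scale[OF quad, of "\<lambda>p. u p + v p" \<i>] assms
  by (simp add: real_polar_def algebra_simps)

lemma real_polar_minus:
  assumes "finsupp u" "finsupp v"
  shows "real_polar a (\<lambda>p. - u p) v = - real_polar a u v"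
  using real_polar_add[of u "\<lambda>p. -1 * u p" v] assms real_polar_zero[of v] finsupp_scale[of u "-1"] by simp

lemma real_polar_self:
  assumes "finsupp u" shows "real_polar a u u = a u"
  using quadratic_form_scale[OF quad, of u 2] quadratic_form_zero[OF quad] assms
  by (simp add: real_polar_def)

lemma real_polar_self_rotate:
  assumes "finsupp u" shows "real_polar a u (\<lambda>p. \<i> * u p) = 0"
proof -
  have "real_polar a u (\<lambda>p. \<i> * u p) = real_polar a (\<lambda>p. \<i> * u p) (\<lambda>p. \<i> * (\<i> * u p))"
    using assms by (intro real_polar_rotate[symmetric]) auto
  also have "(\<lambda>p. \<i> * (\<i> * u p)) = (\<lambda>p. - u p)" by (simp add: mult.assoc[symmetric])
  also have "real_polar a (\<lambda>p. \<i> * u p) (\<lambda>p. - u p) = real_polar a (\<lambda>p. - u p) (\<lambda>p. \<i> * u p)"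
    using assms finsupp_scale[of u "-1"] by (intro real_polar_commute) auto
  also have "\<dots> = - real_polar a u (\<lambda>p. \<i> * u p)" using assms by (intro real_polar_minus) auto
  finally show ?thesis by simp
qed

lemma polar_self: "finsupp u \<Longrightarrow> polar a u u = complex_of_real (a u)"
  by (simp add: polar_def real_polar_self real_polar_self_rotate complex_eq_iff)

lemma polar_add:
  assumes "finsupp u" "finsupp u'" "finsupp v"
  shows "polar a (\<lambda>p. u p + u' p) v = polar a u v + polar a u' v"
  using assms by (simp add: polar_def real_polar_add complex_eq_iff)

lemma polar_cnj:
  assumes "finsupp u" "finsupp v"
  shows "polar a v u = cnj (polar a u v)"
proof -
  have "real_polar a v (\<lambda>p. \<i> * u p) = real_polar a (\<lambda>p. \<i> * v p) (\<lambda>p. \<i> * (\<i> * u p))"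
    using assms by (intro real_polar_rotate[symmetric]) auto
  also have "(\<lambda>p. \<i> * (\<i> * u p)) = (\<lambda>p. - u p)" by (simp add: mult.assoc[symmetric])
  also have "real_polar a (\<lambda>p. \<i> * v p) (\<lambda>p. - u p) = real_polar a (\<lambda>p. - u p) (\<lambda>p. \<i> * v p)"
    using assms finsupp_scale[of u "-1"] by (intro real_polar_commute) auto
  also have "\<dots> = - real_polar a u (\<lambda>p. \<i> * v p)" using assms by (intro real_polar_minus) auto
  finally show ?thesis using real_polar_commute assms by (simp add: polar_def complex_eq_iff)
qed

lemma polar_rotate:
  assumes "finsupp u" "finsupp v"
  shows "polar a (\<lambda>p. \<i> * u p) v = \<i> * polar a u v"
proof -
  have "real_polar a (\<lambda>p. \<i> * u p) v = real_polar a v (\<lambda>p. \<i> * u p)"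
    using assms by (intro real_polar_commute) auto
  also have "\<dots> = - real_polar a u (\<lambda>p. \<i> * v p)"
    using polar_cnj[OF assms] by (simp add: polar_def complex_eq_iff)
  finally show ?thesis using real_polar_rotate[OF assms] by (simp add: polar_def complex_eq_iff)
qed

context
  assumes nonneg: "\<And>u. finsupp u \<Longrightarrow> 0 \<le> a u"
begin

lemma abs_real_polar_le:
  assumes "finsupp u" "finsupp v"
  shows "\<bar>real_polar a u v\<bar> \<le> (a u + a v) / 2"
  using quadratic_form_parallelogram[OF quad assms] nonneg[of "\<lambda>p. u p + v p"] nonneg[of "\<lambda>p. u p - v p"] assms
  by (simp add: real_polar_def)

text \<open>
The parallelogram law only gives additivity in \<open>u\<close>. Homogeneity needs positivity: the deviation
\<open>g s\<close> from linearity is additive in \<open>s\<close>, vanishes at the integers and is bounded on the unit interval,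
hence bounded everywhere, and a bounded additive function is zero.
\<close>

lemma real_polar_scale:
  assumes "finsupp u" "finsupp v"
  shows "real_polar a (\<lambda>p. of_real t * u p) v = t * real_polar a u v"
proof -
  define g where "g s = real_polar a (\<lambda>p. of_real s * u p) v - s * real_polar a u v" for s :: real
  have add: "g (s + s') = g s + g s'" for s s'
    using real_polar_add[of "\<lambda>p. of_real s * u p" "\<lambda>p. of_real s' * u p" v] assms
    by (simp add: g_def algebra_simps)
  have g1: "g 1 = 0" by (simp add: g_def)
  have g0: "g 0 = 0" using add[of 0 0] by simp
  have neg: "g (- s) = - g s" for s using add[of s "-s"] g0 by simp
  have nat: "g (real n * s) = real n * g s" for n s
    by (induction n) (auto simp: g0 add algebra_simps)
  have int: "g (of_int k) = 0" for k
    using nat[of "nat \<bar>k\<bar>" 1] neg[of "of_int \<bar>k\<bar>"] g1 by (cases "k \<ge> 0") (auto)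
  define C where "C = (a u + a v) / 2 + \<bar>real_polar a u v\<bar>"
  have bound: "\<bar>g s\<bar> \<le> C" if "0 \<le> s" "s \<le> 1" for s
  proof -
    have "\<bar>real_polar a (\<lambda>p. of_real s * u p) v\<bar> \<le> (a (\<lambda>p. of_real s * u p) + a v) / 2"
      using assms by (intro abs_real_polar_le) auto
    also have "a (\<lambda>p. of_real s * u p) = s\<^sup>2 * a u"
      using quadratic_form_scale[OF quad assms(1), of "of_real s"] by simp
    also have "s\<^sup>2 * a u \<le> 1 * a u"
      using that nonneg[OF assms(1)] by (intro mult_right_mono) (auto simp: power_le_one)
    finally have "\<bar>real_polar a (\<lambda>p. of_real s * u p) v\<bar> \<le> (a u + a v) / 2" by simp
    moreover have "\<bar>s * real_polar a u v\<bar> \<le> \<bar>real_polar a u v\<bar>"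
      using that by (simp add: abs_mult mult_left_le_one_le)
    ultimately show ?thesis unfolding g_def C_def by linarith
  qed
  have "real n * \<bar>g t\<bar> \<le> C" for n
  proof -
    have "real n * \<bar>g t\<bar> = \<bar>g (real n * t)\<bar>" by (simp add: nat abs_mult)
    also have "g (real n * t) = g (frac (real n * t)) + g (of_int \<lfloor>real n * t\<rfloor>)"
      using add[of "frac (real n * t)" "of_int \<lfloor>real n * t\<rfloor>"] by (simp add: frac_def)
    also have "\<bar>\<dots>\<bar> \<le> C" using bound[of "frac (real n * t)"] int frac_lt_1[of "real n * t"] by simp
    finally show ?thesis .
  qed
  then have "g t = 0"
    by (metis abs_le_zero_iff abs_not_less_zero linorder_not_less reals_Archimedean3 zero_less_abs_iff)
  then show ?thesis by (simp add: g_def)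
qed

lemma polar_scale:
  assumes "finsupp u" "finsupp v"
  shows "polar a (\<lambda>p. c * u p) v = c * polar a u v"
proof -
  have r: "polar a (\<lambda>p. of_real t * w p) v = of_real t * polar a w v" if "finsupp w" for t w
    using real_polar_scale assms that by (simp add: polar_def complex_eq_iff)
  have e: "(\<lambda>p. c * u p) = (\<lambda>p. of_real (Re c) * u p + \<i> * (of_real (Im c) * u p))"
    by (rule ext) (simp add: complex_eq_iff algebra_simps)
  have "polar a (\<lambda>p. c * u p) v = of_real (Re c) * polar a u v + \<i> * (of_real (Im c) * polar a u v)"
    unfolding e using assms by (simp add: polar_add polar_rotate r)
  also have "\<dots> = c * polar a u v" by (simp add: complex_eq_iff algebra_simps)
  finally show ?thesis .
qed

lemma polar_sum_left:
  assumes "finite S" "finsupp v"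
  shows "polar a (\<lambda>p. \<Sum>q\<in>S. c q * unit_at q p) v = (\<Sum>q\<in>S. c q * polar a (unit_at q) v)
     \<and> finsupp (\<lambda>p. \<Sum>q\<in>S. c q * unit_at q p)"
  using assms(1)
proof (induction S)
  case empty
  then show ?case using polar_scale[of "\<lambda>p. 0" v 0] assms by simp
next
  case (insert q S)
  then show ?case using assms by (simp add: polar_add polar_scale)
qed

text \<open>
The theorem of Jordan and von Neumann in coordinates: a positive form that satisfies the
parallelogram law is given by a Hermitian matrix.
\<close>

lemma quadratic_form_eq_sum:
  assumes "finite S" "\<And>p. p \<notin> S \<Longrightarrow> u p = 0"
  shows "complex_of_real (a u) = (\<Sum>p\<in>S. \<Sum>q\<in>S. polar a (unit_at q) (unit_at p) * u q * cnj (u p))"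
proof -
  have fu: "finsupp u" using assms by (rule finsupp_superset)
  have u: "u = (\<lambda>p. \<Sum>q\<in>S. u q * unit_at q p)"
  proof
    fix p show "u p = (\<Sum>q\<in>S. u q * unit_at q p)"
      using assms by (cases "p \<in> S") (auto simp: unit_at_def if_distrib cong: if_cong)
  qed
  have left: "polar a u v = (\<Sum>q\<in>S. u q * polar a (unit_at q) v)" if "finsupp v" for v
    using polar_sum_left[OF assms(1) that, of u] u by metis
  have "complex_of_real (a u) = (\<Sum>q\<in>S. u q * polar a (unit_at q) u)"
    using left[OF fu] polar_self[OF fu] by simp
  also have "\<dots> = (\<Sum>q\<in>S. u q * cnj (\<Sum>p\<in>S. u p * polar a (unit_at p) (unit_at q)))"
    using polar_cnj[OF fu] left by (intro sum.cong refl) simp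
  also have "\<dots> = (\<Sum>q\<in>S. \<Sum>p\<in>S. polar a (unit_at q) (unit_at p) * u q * cnj (u p))"
    by (intro sum.cong refl, simp add: sum_distrib_left, intro sum.cong refl)
       (subst polar_cnj, simp_all add: mult_ac)
  also have "\<dots> = (\<Sum>p\<in>S. \<Sum>q\<in>S. polar a (unit_at q) (unit_at p) * u q * cnj (u p))"
    by (rule sum.swap)
  finally show ?thesis .
qed

lemma cmod_polar_le:
  assumes "finsupp u" "finsupp v"
  shows "cmod (polar a u v) \<le> a u + a v"
proof -
  have "cmod (polar a u v) \<le> \<bar>real_polar a u v\<bar> + \<bar>real_polar a u (\<lambda>p. \<i> * v p)\<bar>"
    using cmod_le[of "polar a u v"] by (simp add: polar_def)
  also have "\<dots> \<le> (a u + a v) / 2 + (a u + a (\<lambda>p. \<i> * v p)) / 2"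
    using assms by (intro add_mono abs_real_polar_le) auto
  also have "a (\<lambda>p. \<i> * v p) = a v" using quadratic_form_scale[OF quad assms(2), of \<i>] by simp
  finally show ?thesis by (simp add: field_simps)
qed

end
end

lemma polar_add_form: "polar (\<lambda>u. a u + b u) x y = polar a x y + polar b x y"
  and polar_diff_form: "polar (\<lambda>u. a u - b u) x y = polar a x y - polar b x y"
  by (simp_all add: polar_def real_polar_def complex_eq_iff diff_divide_distrib add_divide_distrib)

lemma polar_sum_form: "polar (\<lambda>u. \<Sum>i\<in>I. a i u) x y = (\<Sum>i\<in>I. polar (a i) x y)"
proof (induction I rule: infinite_finite_induct)
  case (insert i I)
  then show ?case by (simp add: polar_add_form)
qed (simp_all add: polar_def real_polar_def complex_eq_iff)

lemma polar_cong:
  assumes "\<And>u. finsupp u \<Longrightarrow> a u = b u" "finsupp x" "finsupp y"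
  shows "polar a x y = polar b x y"
  using assms by (simp add: polar_def real_polar_def)

lemma polar_cmod_linear:
  assumes "\<And>u v. finsupp u \<Longrightarrow> finsupp v \<Longrightarrow> L (\<lambda>p. u p + v p) = L u + L v"
    and "\<And>u v. finsupp u \<Longrightarrow> finsupp v \<Longrightarrow> L (\<lambda>p. u p - v p) = L u - L v"
    and "\<And>b u. finsupp u \<Longrightarrow> L (\<lambda>p. b * u p) = b * L u"
    and fin: "finsupp x" "finsupp y"
  shows "polar (\<lambda>u. (cmod (L u))\<^sup>2) x y = L x * cnj (L y)"
  using fin finsupp_scale[OF fin(2), of \<i>]
  unfolding polar_def real_polar_def complex_eq_iff
  by (simp add: assms(1-3) cmod_power2) (simp add: power2_eq_square algebra_simps)

section \<open>Shifts and Toeplitz operators on sequences over the plane lattice\<close>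

definition sqnorm :: "('i \<Rightarrow> complex) \<Rightarrow> real" where
  "sqnorm u = (\<Sum>p | u p \<noteq> 0. (cmod (u p))\<^sup>2)"

lemma sqnorm_eq_sum:
  assumes "finite S" "\<And>p. p \<notin> S \<Longrightarrow> u p = 0"
  shows "sqnorm u = (\<Sum>p\<in>S. (cmod (u p))\<^sup>2)"
  unfolding sqnorm_def by (rule sum.mono_neutral_left) (use assms in auto)

lemma sqnorm_nonneg: "0 \<le> sqnorm u"
  unfolding sqnorm_def by (rule sum_nonneg) auto

lemma cmod_parallelogram: "(cmod (x + y))\<^sup>2 + (cmod (x - y))\<^sup>2 = 2 * (cmod x)\<^sup>2 + 2 * (cmod y)\<^sup>2"
  unfolding cmod_power2 by (simp add: power2_eq_square algebra_simps)

lemma quadratic_form_sqnorm: "quadratic_form sqnorm"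
proof (rule quadratic_formI)
  fix u v :: "'a \<Rightarrow> complex" assume fin: "finsupp u" "finsupp v"
  define S where "S = {p. u p \<noteq> 0} \<union> {p. v p \<noteq> 0}"
  have "finite S" using fin by (simp add: S_def finsupp_def)
  then have *: "sqnorm w = (\<Sum>p\<in>S. (cmod (w p))\<^sup>2)" if "\<And>p. u p = 0 \<Longrightarrow> v p = 0 \<Longrightarrow> w p = 0" for w
    using that by (intro sqnorm_eq_sum) (auto simp: S_def)
  show "sqnorm (\<lambda>p. u p + v p) + sqnorm (\<lambda>p. u p - v p) = 2 * sqnorm u + 2 * sqnorm v"
    by (simp add: * sum.distrib[symmetric] cmod_parallelogram sum_distrib_left)
next
  fix c and u :: "'a \<Rightarrow> complex" assume "finsupp u"
  then show "sqnorm (\<lambda>p. c * u p) = (cmod c)\<^sup>2 * sqnorm u"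
    using sqnorm_eq_sum[of "{p. u p \<noteq> 0}" "\<lambda>p. c * u p"]
    by (simp add: finsupp_def sqnorm_def norm_mult power_mult_distrib sum_distrib_left)
qed

lemma sqnorm_restrict_le: "finsupp u \<Longrightarrow> sqnorm (\<lambda>p. if P p then u p else 0) \<le> sqnorm u"
  unfolding sqnorm_def[of u]
  by (subst sqnorm_eq_sum[of "{p. u p \<noteq> 0}"]) (auto simp: finsupp_def intro!: sum_mono)

lemma sqnorm_split:
  assumes "finsupp u"
  shows "sqnorm u = sqnorm (\<lambda>p. if P p then u p else 0) + sqnorm (\<lambda>p. if P p then 0 else u p)"
proof -
  have f: "finite {p. u p \<noteq> 0}" using assms by (simp add: finsupp_def)
  show ?thesis
    by (subst (1 2 3) sqnorm_eq_sum[OF f]) (auto simp: sum.distrib[symmetric] intro!: sum.cong)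
qed

definition shift :: "int \<Rightarrow> int \<Rightarrow> (int \<times> int \<times> 'n \<Rightarrow> complex) \<Rightarrow> int \<times> int \<times> 'n \<Rightarrow> complex" where
  "shift d e u = (\<lambda>(i, j, s). u (i + d, j + e, s))"

lemma shift_apply [simp]: "shift d e u (i, j, s) = u (i + d, j + e, s)"
  by (simp add: shift_def)

lemma shift_support: "{p. shift d e u p \<noteq> 0} = (\<lambda>(i, j, s). (i - d, j - e, s)) ` {p. u p \<noteq> 0}"
  by (force simp: shift_def image_iff split: prod.splits)

lemma inj_translate: "inj_on (\<lambda>(i, j, s). (i - d :: int, j - e :: int, s)) A"
  by (auto simp: inj_on_def)

lemma finsupp_shift [simp]: "finsupp u \<Longrightarrow> finsupp (shift d e u)"
  by (simp add: finsupp_def shift_support)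

lemma sqnorm_shift [simp]: "sqnorm (shift d e u) = sqnorm u"
  unfolding sqnorm_def shift_support
  by (subst sum.reindex[OF inj_translate]) (auto intro!: sum.cong)

lemma shift_add: "shift d e (\<lambda>p. u p + v p) = (\<lambda>p. shift d e u p + shift d e v p)"
  and shift_diff: "shift d e (\<lambda>p. u p - v p) = (\<lambda>p. shift d e u p - shift d e v p)"
  and shift_scale: "shift d e (\<lambda>p. c * u p) = (\<lambda>p. c * shift d e u p)"
  by (auto simp: shift_def)

lemma quadratic_form_shift:
  assumes "quadratic_form a" shows "quadratic_form (\<lambda>u. a (shift d e u))"
  using assms by (intro quadratic_formI)
    (auto simp: shift_add shift_diff shift_scale quadratic_form_scale intro!: quadratic_form_parallelogram)

text \<open>
The symbol \<open>c\<close> is indexed by differences of lattice points. The coefficient \<open>c (k - i) (l - j)\<close> carries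
the value at \<open>(k, l)\<close> to the value at \<open>(i, j)\<close>, so with Taylor coefficients as symbol the operator moves mass
down and to the left, like the adjoint of an analytic multiplication operator.
\<close>

definition toeplitz ::
  "(int \<Rightarrow> int \<Rightarrow> 'm \<Rightarrow> 'n \<Rightarrow> complex) \<Rightarrow> (int \<times> int \<times> 'n \<Rightarrow> complex) \<Rightarrow> int \<times> int \<times> 'm \<Rightarrow> complex" where
  "toeplitz c u = (\<lambda>(i, j, m). \<Sum>(k, l, s) | u (k, l, s) \<noteq> 0. c (k - i) (l - j) m s * u (k, l, s))"

lemma toeplitz_eq_sum:
  assumes "finite S" "\<And>p. p \<notin> S \<Longrightarrow> u p = 0"
  shows "toeplitz c u (i, j, m) = (\<Sum>(k, l, s)\<in>S. c (k - i) (l - j) m s * u (k, l, s))"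
  unfolding toeplitz_def split by (rule sum.mono_neutral_left) (use assms in auto)

lemma toeplitz_shift: "toeplitz c (shift d e u) = shift d e (toeplitz c u)"
proof -
  have "toeplitz c (shift d e u) (i, j, m) = toeplitz c u (i + d, j + e, m)" for i j m
  proof -
    have "{(k, l, s). shift d e u (k, l, s) \<noteq> 0} = {p. shift d e u p \<noteq> 0}"
      "{(k, l, s). u (k, l, s) \<noteq> 0} = {p. u p \<noteq> 0}" by auto
    then show ?thesis
      unfolding toeplitz_def split shift_support
      by (simp only:, subst sum.reindex[OF inj_translate]) (auto intro!: sum.cong simp: algebra_simps)
  qed
  then show ?thesis by (auto simp: fun_eq_iff)
qed

lemma
  assumes "finsupp u" "finsupp v"
  shows toeplitz_add: "toeplitz c (\<lambda>p. u p + v p) y = toeplitz c u y + toeplitz c v y"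
    and toeplitz_diff: "toeplitz c (\<lambda>p. u p - v p) y = toeplitz c u y - toeplitz c v y"
proof -
  obtain i j m where y: "y = (i, j, m)" by (cases y)
  define S where "S = {p. u p \<noteq> 0} \<union> {p. v p \<noteq> 0}"
  have "finite S" using assms by (simp add: S_def finsupp_def)
  then have *: "toeplitz c w (i, j, m) = (\<Sum>(k, l, s)\<in>S. c (k - i) (l - j) m s * w (k, l, s))"
    if "\<And>p. u p = 0 \<Longrightarrow> v p = 0 \<Longrightarrow> w p = 0" for w
    using that by (intro toeplitz_eq_sum) (auto simp: S_def)
  show "toeplitz c (\<lambda>p. u p + v p) y = toeplitz c u y + toeplitz c v y"
    unfolding y by (simp add: * sum.distrib[symmetric] algebra_simps case_prod_unfold)
  show "toeplitz c (\<lambda>p. u p - v p) y = toeplitz c u y - toeplitz c v y"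
    unfolding y by (simp add: * sum_subtractf[symmetric] algebra_simps case_prod_unfold)
qed

lemma toeplitz_scale:
  assumes "finsupp u"
  shows "toeplitz c (\<lambda>p. b * u p) y = b * toeplitz c u y"
proof -
  obtain i j m where y: "y = (i, j, m)" by (cases y)
  have "finite {p. u p \<noteq> 0}" using assms by (simp add: finsupp_def)
  then have *: "toeplitz c w (i, j, m) = (\<Sum>(k, l, s)\<in>{p. u p \<noteq> 0}. c (k - i) (l - j) m s * w (k, l, s))"
    if "\<And>p. u p = 0 \<Longrightarrow> w p = 0" for w
    using that by (intro toeplitz_eq_sum) auto
  show ?thesis
    unfolding y by (simp add: * sum_distrib_left algebra_simps case_prod_unfold)
qed

lemma quadratic_form_cmod_toeplitz: "quadratic_form (\<lambda>u. (cmod (toeplitz c u y))\<^sup>2)"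
  by (rule quadratic_formI)
    (auto simp: toeplitz_add toeplitz_diff toeplitz_scale cmod_parallelogram norm_mult power_mult_distrib)

lemma polar_shift: "polar (\<lambda>u. a (shift d e u)) x y = polar a (shift d e x) (shift d e y)"
  by (simp add: polar_def real_polar_def shift_add shift_diff shift_scale)

lemma quadratic_form_sum: "(\<And>y. y \<in> F \<Longrightarrow> quadratic_form (a y)) \<Longrightarrow> quadratic_form (\<lambda>u. \<Sum>y\<in>F. a y u)"
proof (induction F rule: infinite_finite_induct)
  case (insert y F)
  then show ?case by (simp add: quadratic_form_add)
qed (simp_all add: quadratic_form_def)

text \<open>
The ray \<open>i = 0, j \<ge> 0\<close> is what remains of the quadrant when the quadrant shifted by one step to the
right is removed.
\<close>

definition on_ray :: "(int \<times> int \<times> 'k \<Rightarrow> complex) \<Rightarrow> int \<times> int \<times> 'k \<Rightarrow> complex" where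
  "on_ray u = (\<lambda>p. if fst p = 0 \<and> 0 \<le> fst (snd p) then u p else 0)"

lemma finsupp_on_ray [simp]: "finsupp u \<Longrightarrow> finsupp (on_ray u)"
  unfolding on_ray_def by (rule finsupp_restrict)

text \<open>
The linear map \<open>L\<close> will be the identity and a Toeplitz operator.
\<close>

lemma quadratic_form_on_ray:
  assumes "\<And>u v p. finsupp u \<Longrightarrow> finsupp v \<Longrightarrow> L (\<lambda>p. u p + v p) p = L u p + L v p"
    and "\<And>u v p. finsupp u \<Longrightarrow> finsupp v \<Longrightarrow> L (\<lambda>p. u p - v p) p = L u p - L v p"
    and "\<And>b u p. finsupp u \<Longrightarrow> L (\<lambda>p. b * u p) p = b * L u p"
    and fin: "\<And>u. finsupp u \<Longrightarrow> finsupp (on_ray (L u))"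
  shows "quadratic_form (\<lambda>x. sqnorm (on_ray (L x)))"
proof (rule quadratic_formI)
  fix u v :: "'a \<Rightarrow> complex" assume f: "finsupp u" "finsupp v"
  have "on_ray (L (\<lambda>p. u p + v p)) = (\<lambda>p. on_ray (L u) p + on_ray (L v) p)"
    "on_ray (L (\<lambda>p. u p - v p)) = (\<lambda>p. on_ray (L u) p - on_ray (L v) p)"
    using assms(1,2)[OF f] by (auto simp: on_ray_def)
  then show "sqnorm (on_ray (L (\<lambda>p. u p + v p))) + sqnorm (on_ray (L (\<lambda>p. u p - v p))) =
      2 * sqnorm (on_ray (L u)) + 2 * sqnorm (on_ray (L v))"
    using quadratic_form_parallelogram[OF quadratic_form_sqnorm fin[OF f(1)] fin[OF f(2)]] by simp
next
  fix b and u :: "'a \<Rightarrow> complex" assume f: "finsupp u"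
  have "on_ray (L (\<lambda>p. b * u p)) = (\<lambda>p. b * on_ray (L u) p)"
    using assms(3)[OF f] by (auto simp: on_ray_def)
  then show "sqnorm (on_ray (L (\<lambda>p. b * u p))) = (cmod b)\<^sup>2 * sqnorm (on_ray (L u))"
    using quadratic_form_scale[OF quadratic_form_sqnorm fin[OF f]] by simp
qed

lemma sqnorm_on_ray_shift:
  fixes g :: "int \<times> int \<times> 'k::finite \<Rightarrow> complex"
  assumes "finsupp (on_ray g)"
  shows "sqnorm (on_ray g) = (\<Sum>s\<in>UNIV. (cmod (g (0, 0, s)))\<^sup>2) + sqnorm (on_ray (shift 0 1 g))"
proof -
  let ?P = "\<lambda>p. fst (snd p) = 0"
  have "sqnorm (\<lambda>p. if ?P p then on_ray g p else 0)
      = (\<Sum>p\<in>(\<lambda>s. (0, 0, s)) ` UNIV. (cmod (if ?P p then on_ray g p else 0))\<^sup>2)"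
    by (rule sqnorm_eq_sum) (auto simp: on_ray_def image_iff)
  also have "\<dots> = (\<Sum>s\<in>UNIV. (cmod (g (0, 0, s)))\<^sup>2)"
    by (subst sum.reindex) (auto simp: inj_on_def on_ray_def)
  finally have 1: "sqnorm (\<lambda>p. if ?P p then on_ray g p else 0) = (\<Sum>s\<in>UNIV. (cmod (g (0, 0, s)))\<^sup>2)" .
  have "on_ray (shift 0 1 g) = shift 0 1 (\<lambda>p. if ?P p then 0 else on_ray g p)"
    by (auto simp: on_ray_def shift_def fun_eq_iff)
  then have "sqnorm (on_ray (shift 0 1 g)) = sqnorm (\<lambda>p. if ?P p then 0 else on_ray g p)" by simp
  with 1 sqnorm_split[OF assms, of ?P] show ?thesis by simp
qed

section \<open>Splitting the defect of a contractive Toeplitz operator\<close>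

text \<open>
Such a form lives on sequences over the quadrant although it is defined on sequences over the whole
lattice. This lets the backward shifts act without cutting off values that leave the quadrant.
\<close>

definition quadrant_local :: "((int \<times> int \<times> 'n \<Rightarrow> complex) \<Rightarrow> real) \<Rightarrow> bool" where
  "quadrant_local a \<longleftrightarrow> (\<forall>x x'. finsupp x \<longrightarrow> finsupp x' \<longrightarrow>
     (\<forall>i j s. 0 \<le> i \<longrightarrow> 0 \<le> j \<longrightarrow> x (i, j, s) = x' (i, j, s)) \<longrightarrow> a x = a x')"

locale contractive_symbol =
  fixes c :: "int \<Rightarrow> int \<Rightarrow> 'm::finite \<Rightarrow> 'n::finite \<Rightarrow> complex"
  assumes causal: "i < 0 \<or> j < 0 \<Longrightarrow> c i j m s = 0"
    and contractive: "finsupp u \<Longrightarrow> finite F \<Longrightarrow> (\<Sum>y\<in>F. (cmod (toeplitz c u y))\<^sup>2) \<le> sqnorm u"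
begin

text \<open>
Causality: the value at \<open>(i, j)\<close> only depends on the entries above and to the right of \<open>(i, j)\<close>.
\<close>

lemma toeplitz_cong:
  assumes "finsupp u" "finsupp v" "\<And>k l s. i \<le> k \<Longrightarrow> j \<le> l \<Longrightarrow> u (k, l, s) = v (k, l, s)"
  shows "toeplitz c u (i, j, m) = toeplitz c v (i, j, m)"
proof -
  define S where "S = {p. u p \<noteq> 0} \<union> {p. v p \<noteq> 0}"
  have "finite S" using assms by (simp add: S_def finsupp_def)
  then have *: "toeplitz c w (i, j, m) = (\<Sum>(k, l, s)\<in>S. c (k - i) (l - j) m s * w (k, l, s))"
    if "\<And>p. u p = 0 \<Longrightarrow> v p = 0 \<Longrightarrow> w p = 0" for w
    using that by (intro toeplitz_eq_sum) (auto simp: S_def)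
  have eq: "c (k - i) (l - j) m s * u (k, l, s) = c (k - i) (l - j) m s * v (k, l, s)" for k l s
    using assms(3)[of k l s] causal[of "k - i" "l - j"] by (cases "i \<le> k \<and> j \<le> l") auto
  show ?thesis by (simp add: *, intro sum.cong refl) (use eq in auto)
qed

text \<open>
Only finitely many values of \<open>T u\<close> are subtracted. Since \<open>defect F u\<close> decreases in \<open>F\<close>, an infimum that
runs over finite \<open>F\<close> in the half plane as well accounts for the square sum of \<open>T u\<close> over the half plane.
\<close>

definition defect :: "(int \<times> int \<times> 'm) set \<Rightarrow> (int \<times> int \<times> 'n \<Rightarrow> complex) \<Rightarrow> real" where
  "defect F u = sqnorm u - (\<Sum>y\<in>F. (cmod (toeplitz c u y))\<^sup>2)"

lemma quadratic_form_defect: "quadratic_form (defect F)"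
  unfolding defect_def [abs_def]
  by (intro quadratic_form_diff quadratic_form_sqnorm quadratic_form_sum quadratic_form_cmod_toeplitz)

lemma defect_nonneg: "finite F \<Longrightarrow> finsupp u \<Longrightarrow> 0 \<le> defect F u"
  using contractive by (simp add: defect_def)

lemma defect_antimono: "finite F' \<Longrightarrow> F \<subseteq> F' \<Longrightarrow> defect F' u \<le> defect F u"
  unfolding defect_def by (simp add: sum_mono2)

text \<open>
The competitors in the definition of the shorted form. They depend on the values of \<open>x\<close> on the
quadrant only.
\<close>

definition extensions ::
  "(int \<times> int \<times> 'n \<Rightarrow> complex) \<Rightarrow> ((int \<times> int \<times> 'm) set \<times> (int \<times> int \<times> 'n \<Rightarrow> complex)) set" where
  "extensions x = {(F, u). finite F \<and> (\<forall>(i, j, m)\<in>F. 0 \<le> i) \<and> finsupp u \<and>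
     (\<forall>i j s. i < 0 \<longrightarrow> u (i, j, s) = 0) \<and> (\<forall>i j s. 0 \<le> i \<longrightarrow> 0 \<le> j \<longrightarrow> u (i, j, s) = x (i, j, s))}"

definition shorted :: "(int \<times> int \<times> 'n \<Rightarrow> complex) \<Rightarrow> real" where
  "shorted x = (INF (F, u)\<in>extensions x. defect F u)"

lemma extensions_cong:
  "(\<And>i j s. 0 \<le> i \<Longrightarrow> 0 \<le> j \<Longrightarrow> x (i, j, s) = x' (i, j, s)) \<Longrightarrow> extensions x = extensions x'"
  by (auto simp: extensions_def)

lemma extensions_restrict:
  "finsupp x \<Longrightarrow> ({}, \<lambda>p. if 0 \<le> fst p \<and> 0 \<le> fst (snd p) then x p else 0) \<in> extensions x"
  by (auto simp: extensions_def)

lemma shorted_le: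
  assumes "(F, u) \<in> extensions x" shows "shorted x \<le> defect F u"
proof -
  have "bdd_below ((\<lambda>(F, u). defect F u) ` extensions x)"
    by (rule bdd_belowI[of _ 0]) (auto simp: extensions_def defect_nonneg)
  from cINF_lower[OF this assms] show ?thesis by (simp add: shorted_def)
qed

lemma shorted_greatest:
  assumes "finsupp x" "\<And>F u. (F, u) \<in> extensions x \<Longrightarrow> b \<le> defect F u"
  shows "b \<le> shorted x"
  unfolding shorted_def using extensions_restrict[OF assms(1)] assms(2)
  by (intro cINF_greatest) auto

lemma shorted_nonneg: "finsupp x \<Longrightarrow> 0 \<le> shorted x"
  by (rule shorted_greatest) (auto simp: extensions_def defect_nonneg)

lemma shorted_le_sqnorm: 
  assumes "finsupp x" shows "shorted x \<le> sqnorm x"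
  using order_trans[OF shorted_le[OF extensions_restrict[OF assms]]] sqnorm_restrict_le[OF assms]
  by (simp add: defect_def)

text \<open>
If \<open>u\<close> and \<open>u'\<close> compete for \<open>x\<close> and \<open>x'\<close>, then \<open>u + u'\<close> and \<open>u - u'\<close> compete for \<open>x + x'\<close> and
\<open>x - x'\<close>, and \<open>F \<union> F'\<close> serves both because the defect is antimonotone in the finite set.
\<close>

lemma shorted_parallelogram_le:
  assumes "finsupp x" "finsupp x'"
  shows "shorted (\<lambda>p. x p + x' p) + shorted (\<lambda>p. x p - x' p) \<le> 2 * shorted x + 2 * shorted x'"
proof -
  let ?l = "shorted (\<lambda>p. x p + x' p) + shorted (\<lambda>p. x p - x' p)"
  have main: "?l \<le> 2 * defect F u + 2 * defect F' u'"
    if e: "(F, u) \<in> extensions x" "(F', u') \<in> extensions x'" for F u F' u'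
  proof -
    have fin: "finite F" "finite F'" "finsupp u" "finsupp u'" using e by (auto simp: extensions_def)
    have "(F \<union> F', \<lambda>p. u p + u' p) \<in> extensions (\<lambda>p. x p + x' p)"
      and "(F \<union> F', \<lambda>p. u p - u' p) \<in> extensions (\<lambda>p. x p - x' p)"
      using e by (auto simp: extensions_def)
    then have "?l \<le> defect (F \<union> F') (\<lambda>p. u p + u' p) + defect (F \<union> F') (\<lambda>p. u p - u' p)"
      by (intro add_mono shorted_le)
    also have "\<dots> = 2 * defect (F \<union> F') u + 2 * defect (F \<union> F') u'"
      using fin by (intro quadratic_form_parallelogram quadratic_form_defect)
    also have "\<dots> \<le> 2 * defect F u + 2 * defect F' u'"
      using fin by (intro add_mono mult_left_mono defect_antimono) auto
    finally show ?thesis .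
  qed
  have "(?l - 2 * defect F' u') / 2 \<le> shorted x" if "(F', u') \<in> extensions x'" for F' u'
    using that by (intro shorted_greatest assms) (use main in fastforce)
  then have "(?l - 2 * shorted x) / 2 \<le> shorted x'"
    by (intro shorted_greatest assms) fastforce
  then show ?thesis by (simp add: field_simps)
qed

lemma shorted_scale_le:
  assumes "finsupp x"
  shows "shorted (\<lambda>p. b * x p) \<le> (cmod b)\<^sup>2 * shorted x"
proof (cases "b = 0")
  case True
  have "({}, \<lambda>p. 0) \<in> extensions (\<lambda>p. b * x p)" using True by (auto simp: extensions_def)
  from shorted_le[OF this] True show ?thesis by (simp add: defect_def sqnorm_def)
next
  case False
  have "shorted (\<lambda>p. b * x p) / (cmod b)\<^sup>2 \<le> shorted x"
  proof (rule shorted_greatest[OF assms])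
    fix F u assume e: "(F, u) \<in> extensions x"
    then have "finsupp u" and "(F, \<lambda>p. b * u p) \<in> extensions (\<lambda>p. b * x p)"
      by (auto simp: extensions_def)
    then have "shorted (\<lambda>p. b * x p) \<le> (cmod b)\<^sup>2 * defect F u"
      using shorted_le quadratic_form_scale[OF quadratic_form_defect] by metis
    then show "shorted (\<lambda>p. b * x p) / (cmod b)\<^sup>2 \<le> defect F u"
      using False by (simp add: field_simps)
  qed
  then show ?thesis using False by (simp add: field_simps)
qed

lemma shorted_scale:
  assumes "finsupp x"
  shows "shorted (\<lambda>p. b * x p) = (cmod b)\<^sup>2 * shorted x"
proof (cases "b = 0")
  case True
  then show ?thesis using shorted_scale_le[OF assms, of b] shorted_nonneg[of "\<lambda>p. b * x p"] by simp
next
  case False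
  have "shorted (\<lambda>p. inverse b * (b * x p)) \<le> (cmod (inverse b))\<^sup>2 * shorted (\<lambda>p. b * x p)"
    using assms by (intro shorted_scale_le) auto
  then have "(cmod b)\<^sup>2 * shorted x \<le> shorted (\<lambda>p. b * x p)"
    using False by (simp add: norm_divide power_divide field_simps)
  with shorted_scale_le[OF assms, of b] show ?thesis by simp
qed

text \<open>
The opposite half of the parallelogram law is the first half for \<open>u + v\<close> and \<open>u - v\<close>.
\<close>

lemma quadratic_form_shorted: "quadratic_form shorted"
proof (rule quadratic_formI)
  fix u v :: "int \<times> int \<times> 'n \<Rightarrow> complex" assume fin: "finsupp u" "finsupp v"
  have "shorted (\<lambda>p. (u p + v p) + (u p - v p)) + shorted (\<lambda>p. (u p + v p) - (u p - v p))
      \<le> 2 * shorted (\<lambda>p. u p + v p) + 2 * shorted (\<lambda>p. u p - v p)"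
    using fin by (intro shorted_parallelogram_le) auto
  moreover have "(\<lambda>p. (u p + v p) + (u p - v p)) = (\<lambda>p. 2 * u p)"
    "(\<lambda>p. (u p + v p) - (u p - v p)) = (\<lambda>p. 2 * v p)" by auto
  ultimately show "shorted (\<lambda>p. u p + v p) + shorted (\<lambda>p. u p - v p) = 2 * shorted u + 2 * shorted v"
    using shorted_parallelogram_le[OF fin] fin by (simp add: shorted_scale)
qed (rule shorted_scale)

text \<open>
The defect does not change under the vertical shift, which maps competitors for \<open>x\<close> to competitors
for the shifted sequence. The shifted sequence has further competitors, since the values of \<open>x\<close> with
\<open>j = 0\<close> have left the quadrant and are no longer prescribed.
\<close>

lemma shorted_shift_le:
  assumes "finsupp x" shows "shorted (shift 0 1 x) \<le> shorted x"
proof (rule shorted_greatest[OF assms])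
  fix F u assume e: "(F, u) \<in> extensions x"
  let ?t = "\<lambda>(i, j, m). (i - 0 :: int, j - 1 :: int, m)"
  have "(?t ` F, shift 0 1 u) \<in> extensions (shift 0 1 x)"
    using e by (auto simp: extensions_def)
  then have "shorted (shift 0 1 x) \<le> defect (?t ` F) (shift 0 1 u)" by (rule shorted_le)
  also have "\<dots> = defect F u"
    unfolding defect_def toeplitz_shift
    by (subst sum.reindex[OF inj_translate]) (auto intro!: sum.cong)
  finally show "shorted (shift 0 1 x) \<le> defect F u" .
qed

definition ray_defect :: "(int \<times> int \<times> 'n \<Rightarrow> complex) \<Rightarrow> real" where
  "ray_defect x = sqnorm (on_ray x) - sqnorm (on_ray (toeplitz c x))"

lemma finsupp_on_ray_toeplitz [simp]:
  assumes "finsupp x" shows "finsupp (on_ray (toeplitz c x))"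
proof (rule finsupp_superset)
  show "finite (\<Union>(k, l, s)\<in>{p. x p \<noteq> 0}. {0::int} \<times> {0..l} \<times> (UNIV :: 'm set))"
    using assms by (auto simp: finsupp_def)
  fix p :: "int \<times> int \<times> 'm"
  assume n: "p \<notin> (\<Union>(k, l, s)\<in>{p. x p \<noteq> 0}. {0::int} \<times> {0..l} \<times> UNIV)"
  obtain i j m where p: "p = (i, j, m)" by (cases p)
  show "on_ray (toeplitz c x) p = 0"
  proof (cases "i = 0 \<and> 0 \<le> j")
    case True
    have "toeplitz c x (i, j, m) = toeplitz c (\<lambda>p. 0) (i, j, m)"
      using assms True n unfolding p by (intro toeplitz_cong) force+
    also have "\<dots> = 0" by (subst toeplitz_eq_sum[of "{}"]) auto
    finally show ?thesis using True by (simp add: p on_ray_def)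
  qed (auto simp: p on_ray_def)
qed

lemma quadratic_form_ray_defect: "quadratic_form ray_defect"
  unfolding ray_defect_def [abs_def]
  by (intro quadratic_form_diff quadratic_form_on_ray)
     (auto simp: toeplitz_add toeplitz_diff toeplitz_scale)

lemma ray_defect_shift:
  assumes "finsupp x"
  shows "ray_defect x = (\<Sum>s\<in>UNIV. (cmod (x (0, 0, s)))\<^sup>2) - (\<Sum>m\<in>UNIV. (cmod (toeplitz c x (0, 0, m)))\<^sup>2)
     + ray_defect (shift 0 1 x)"
  using sqnorm_on_ray_shift[of x] sqnorm_on_ray_shift[of "toeplitz c x"] assms
  by (simp add: ray_defect_def toeplitz_shift)

text \<open>
A competitor \<open>v\<close> for the backward shift of \<open>x\<close> becomes the competitor \<open>u\<close> for \<open>x\<close> that equals \<open>x\<close> on the ray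
and \<open>v\<close>, moved by one step, to the right of it. By causality \<open>T u\<close> is the moved \<open>T v\<close> on
\<open>i \<ge> 1\<close> and \<open>T x\<close> on the ray; its values at \<open>i = 0, j < 0\<close> could only lower the defect.
\<close>

lemma shorted_le_ray_defect:
  assumes "finsupp x"
  shows "shorted x \<le> ray_defect x + shorted (shift 1 0 x)"
proof -
  have "shorted x - ray_defect x \<le> shorted (shift 1 0 x)"
  proof (rule shorted_greatest)
    show "finsupp (shift 1 0 x)" using assms by simp
    fix F v assume e: "(F, v) \<in> extensions (shift 1 0 x)"
    then have F: "finite F" "\<And>i j m. (i, j, m) \<in> F \<Longrightarrow> 0 \<le> i" and v: "finsupp v"
      and v0: "\<And>i j s. i < 0 \<Longrightarrow> v (i, j, s) = 0"
      and vx: "\<And>i j s. 0 \<le> i \<Longrightarrow> 0 \<le> j \<Longrightarrow> v (i, j, s) = x (i + 1, j, s)"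
      by (auto simp: extensions_def)
    define row :: "int \<times> int \<times> 'n \<Rightarrow> bool" where "row p \<longleftrightarrow> fst p = 0 \<and> 0 \<le> fst (snd p)" for p
    define u where "u p = (if row p then x p else shift (-1) 0 v p)" for p
    \<comment> \<open>The ray part \<open>F0\<close> is all of the ray where \<open>T x\<close> does not vanish; \<open>F1\<close> is \<open>F\<close> moved to the right.\<close>
    define F0 where "F0 = {y. on_ray (toeplitz c x) y \<noteq> 0}"
    define F1 where "F1 = (\<lambda>(i, j, m). (i - (-1) :: int, j - 0 :: int, m)) ` F"
    have F0: "finite F0" using finsupp_on_ray_toeplitz[OF assms] by (simp add: F0_def finsupp_def)
    have F1: "finite F1" using F by (simp add: F1_def)
    have u_eq: "u = (\<lambda>p. on_ray x p + shift (-1) 0 v p)"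
      using v0 by (auto simp: u_def row_def on_ray_def fun_eq_iff)
    have u: "finsupp u" unfolding u_eq using assms v by simp
    have ux: "u (i, j, s) = x (i, j, s)" if "0 \<le> i" "0 \<le> j" for i j s
      using that vx[of "i - 1" j s] by (cases "i = 0") (auto simp: u_def row_def)
    have ext: "(F1 \<union> F0, u) \<in> extensions x"
      using F0 F1 u ux F(2) v0 by (force simp: extensions_def F1_def F0_def on_ray_def u_eq split: if_splits)
    have disj: "F1 \<inter> F0 = {}" using F(2) by (force simp: F1_def F0_def on_ray_def split: if_splits)
    have "sqnorm u = sqnorm (\<lambda>p. if row p then u p else 0) + sqnorm (\<lambda>p. if row p then 0 else u p)"
      by (rule sqnorm_split[OF u])
    also have "(\<lambda>p. if row p then u p else 0) = on_ray x" by (auto simp: u_def row_def on_ray_def)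
    also have "(\<lambda>p. if row p then 0 else u p) = shift (-1) 0 v"
      using v0 by (auto simp: u_def row_def fun_eq_iff)
    finally have nu: "sqnorm u = sqnorm (on_ray x) + sqnorm v" by simp
    have "(\<Sum>y\<in>F0. (cmod (toeplitz c u y))\<^sup>2) = (\<Sum>y\<in>F0. (cmod (on_ray (toeplitz c x) y))\<^sup>2)"
    proof (intro sum.cong refl)
      fix y assume "y \<in> F0"
      then obtain j m where y: "y = (0, j, m)" "0 \<le> j" by (cases y) (auto simp: F0_def on_ray_def split: if_splits)
      have "toeplitz c u y = toeplitz c x y"
        unfolding y using y u ux assms by (intro toeplitz_cong) auto
      then show "(cmod (toeplitz c u y))\<^sup>2 = (cmod (on_ray (toeplitz c x) y))\<^sup>2"
        using y by (simp add: on_ray_def)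
    qed
    then have s0: "(\<Sum>y\<in>F0. (cmod (toeplitz c u y))\<^sup>2) = sqnorm (on_ray (toeplitz c x))"
      by (simp add: sqnorm_def F0_def)
    have "(\<Sum>y\<in>F1. (cmod (toeplitz c u y))\<^sup>2) = (\<Sum>y\<in>F1. (cmod (shift (-1) 0 (toeplitz c v) y))\<^sup>2)"
    proof (intro sum.cong refl)
      fix y assume "y \<in> F1"
      then obtain i j m where y: "y = (i, j, m)" "1 \<le> i" using F(2) by (force simp: F1_def)
      have "toeplitz c u y = toeplitz c (shift (-1) 0 v) y"
        unfolding y using y u v by (intro toeplitz_cong) (auto simp: u_def row_def)
      then show "(cmod (toeplitz c u y))\<^sup>2 = (cmod (shift (-1) 0 (toeplitz c v) y))\<^sup>2"
        by (simp add: toeplitz_shift)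
    qed
    also have "\<dots> = (\<Sum>y\<in>F. (cmod (toeplitz c v y))\<^sup>2)"
      unfolding F1_def by (subst sum.reindex[OF inj_translate]) (auto intro!: sum.cong)
    finally have s1: "(\<Sum>y\<in>F1. (cmod (toeplitz c u y))\<^sup>2) = (\<Sum>y\<in>F. (cmod (toeplitz c v y))\<^sup>2)" .
    have "shorted x \<le> defect (F1 \<union> F0) u" using ext by (rule shorted_le)
    also have "\<dots> = ray_defect x + defect F v"
      using sum.union_disjoint[OF F1 F0 disj, of "\<lambda>y. (cmod (toeplitz c u y))\<^sup>2"]
      by (simp add: defect_def ray_defect_def nu s0 s1)
    finally show "shorted x - ray_defect x \<le> defect F v" by simp
  qed
  then show ?thesis by simp
qed

text \<open>
These are the two forms of the decomposition. The first one becomes the kernel that is multiplied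
by \<open>1 - cnj (w $ 1) * z $ 1\<close>, although it is a difference along the second direction.
\<close>

definition form1 :: "(int \<times> int \<times> 'n \<Rightarrow> complex) \<Rightarrow> real" where
  "form1 x = shorted x - shorted (shift 0 1 x)"

definition form2 :: "(int \<times> int \<times> 'n \<Rightarrow> complex) \<Rightarrow> real" where
  "form2 x = ray_defect x - shorted x + shorted (shift 1 0 x)"

lemma quadratic_form_form1: "quadratic_form form1"
  unfolding form1_def [abs_def]
  by (intro quadratic_form_diff quadratic_form_shorted quadratic_form_shift)

lemma quadratic_form_form2: "quadratic_form form2"
  unfolding form2_def [abs_def]
  by (intro quadratic_form_diff quadratic_form_add quadratic_form_shorted quadratic_form_shift
      quadratic_form_ray_defect)

lemma form1_nonneg: "finsupp x \<Longrightarrow> 0 \<le> form1 x"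
  using shorted_shift_le by (simp add: form1_def)

lemma form2_nonneg: "finsupp x \<Longrightarrow> 0 \<le> form2 x"
  using shorted_le_ray_defect[of x] by (simp add: form2_def)

lemma form1_le: "finsupp x \<Longrightarrow> form1 x \<le> 2 * sqnorm x"
  using shorted_le_sqnorm[of x] shorted_nonneg[of "shift 0 1 x"] sqnorm_nonneg[of x] by (simp add: form1_def)

lemma form2_le: "finsupp x \<Longrightarrow> form2 x \<le> 2 * sqnorm x"
  using shorted_nonneg[of x] shorted_le_sqnorm[of "shift 1 0 x"] sqnorm_nonneg[of "on_ray (toeplitz c x)"]
    sqnorm_restrict_le[of x "\<lambda>p. fst p = 0 \<and> 0 \<le> fst (snd p)"]
  by (simp add: form2_def ray_defect_def on_ray_def)

lemma quadrant_local_form1: "quadrant_local form1"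
  unfolding quadrant_local_def
proof (intro allI impI)
  fix x x' :: "int \<times> int \<times> 'n \<Rightarrow> complex"
  assume "\<forall>i j s. 0 \<le> i \<longrightarrow> 0 \<le> j \<longrightarrow> x (i, j, s) = x' (i, j, s)"
  then show "form1 x = form1 x'"
    using extensions_cong[of x x'] extensions_cong[of "shift 0 1 x" "shift 0 1 x'"]
    by (simp add: form1_def shorted_def)
qed

lemma quadrant_local_form2: "quadrant_local form2"
  unfolding quadrant_local_def
proof (intro allI impI)
  fix x x' :: "int \<times> int \<times> 'n \<Rightarrow> complex"
  assume fin: "finsupp x" "finsupp x'"
    and eq: "\<forall>i j s. 0 \<le> i \<longrightarrow> 0 \<le> j \<longrightarrow> x (i, j, s) = x' (i, j, s)"
  have "on_ray x = on_ray x'" using eq by (auto simp: on_ray_def fun_eq_iff)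
  moreover have "on_ray (toeplitz c x) = on_ray (toeplitz c x')"
    using fin eq by (auto simp: on_ray_def fun_eq_iff intro!: toeplitz_cong)
  ultimately show "form2 x = form2 x'"
    using extensions_cong[of x x'] extensions_cong[of "shift 1 0 x" "shift 1 0 x'"] eq
    by (simp add: form2_def shorted_def ray_defect_def)
qed

text \<open>
The values of \<open>shorted\<close> at \<open>x\<close>, at its two shifts and at its double shift cancel.
\<close>

lemma form_identity:
  assumes "finsupp x"
  shows "form1 x + form2 x = form1 (shift 1 0 x) + form2 (shift 0 1 x) +
    ((\<Sum>s\<in>UNIV. (cmod (x (0, 0, s)))\<^sup>2) - (\<Sum>m\<in>UNIV. (cmod (toeplitz c x (0, 0, m)))\<^sup>2))"
proof -
  have "shift 0 1 (shift 1 0 x) = shift 1 0 (shift 0 1 x)" by (auto simp: shift_def)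
  then show ?thesis using ray_defect_shift[OF assms] by (simp add: form1_def form2_def)
qed

end

section \<open>Coefficients of the two forms\<close>

lemma shift_unit_at: "shift d e (unit_at (i, j, s)) = unit_at (i - d, j - e, s)"
  by (auto simp: shift_def unit_at_def fun_eq_iff)

lemma toeplitz_unit_at: "toeplitz c (unit_at (k, l, s)) (i, j, m) = c (k - i) (l - j) m s"
  by (subst toeplitz_eq_sum[of "{(k, l, s)}"]) (auto simp: unit_at_def)

lemma sqnorm_unit_at: "sqnorm (unit_at p) = 1"
  by (subst sqnorm_eq_sum[of "{p}"]) (auto simp: unit_at_def)

definition form_coeff :: "(('i \<Rightarrow> complex) \<Rightarrow> real) \<Rightarrow> 'i \<Rightarrow> 'i \<Rightarrow> complex" where
  "form_coeff a p q = polar a (unit_at q) (unit_at p)"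

lemma form_coeff_vanish:
  fixes a :: "(int \<times> int \<times> 'n \<Rightarrow> complex) \<Rightarrow> real"
  assumes quad: "quadratic_form a" and loc: "quadrant_local a" and neg: "i < 0 \<or> j < 0"
  shows "form_coeff a p (i, j, s) = 0" "form_coeff a (i, j, s) p = 0"
proof -
  let ?x = "unit_at (i, j, s)"
  have "real_polar a ?x z = 0" if z: "finsupp z" for z
  proof -
    have "a (\<lambda>p. ?x p + z p) = a (\<lambda>p. (-1) * (?x p - z p))"
    proof (rule loc[unfolded quadrant_local_def, rule_format])
      show "finsupp (\<lambda>p. ?x p + z p)" "finsupp (\<lambda>p. (-1) * (?x p - z p))"
        by (rule finsupp_add[OF finsupp_unit_at z], rule finsupp_scale[OF finsupp_diff[OF finsupp_unit_at z]])
      show "?x (k, l, r) + z (k, l, r) = (-1) * (?x (k, l, r) - z (k, l, r))" if "0 \<le> k" "0 \<le> l" for k l r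
        using that neg by (auto simp: unit_at_def)
    qed
    then show ?thesis
      using quadratic_form_scale[OF quad finsupp_diff[OF finsupp_unit_at z], of "-1" "(i, j, s)"]
      by (simp add: real_polar_def)
  qed
  then have u: "polar a ?x (unit_at p) = 0" by (simp add: polar_def complex_eq_iff)
  then show "form_coeff a p (i, j, s) = 0" by (simp add: form_coeff_def)
  show "form_coeff a (i, j, s) p = 0"
    using u polar_cnj[OF quad finsupp_unit_at finsupp_unit_at, of "(i, j, s)" p] by (simp add: form_coeff_def)
qed

text \<open>
The power series of the kernels converge on the bidisk because their coefficients are bounded.
\<close>

lemma form_coeff_bounded:
  assumes "\<And>u. finsupp u \<Longrightarrow> 0 \<le> a u" "quadratic_form a" "\<And>u. finsupp u \<Longrightarrow> a u \<le> 2 * sqnorm u"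
  shows "cmod (form_coeff a p q) \<le> 4"
  using cmod_polar_le[OF assms(2,1), of "unit_at q" "unit_at p"] assms(3)[of "unit_at p"] assms(3)[of "unit_at q"]
  by (simp add: form_coeff_def sqnorm_unit_at)

context contractive_symbol
begin

text \<open>
Polarisation of \<open>form_identity\<close> at two unit vectors; a shift moves the position of a unit vector.
\<close>

lemma form_coeff_identity:
  "form_coeff form1 (i, j, s) (k, l, t) + form_coeff form2 (i, j, s) (k, l, t) =
     form_coeff form1 (i - 1, j, s) (k - 1, l, t) + form_coeff form2 (i, j - 1, s) (k, l - 1, t) +
     ((if i = 0 \<and> j = 0 \<and> k = 0 \<and> l = 0 \<and> s = t then 1 else 0) - (\<Sum>m\<in>UNIV. c k l m t * cnj (c i j m s)))"
proof -
  let ?x = "unit_at (k, l, t)" and ?y = "unit_at (i, j, s)"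
  have "polar (\<lambda>x. form1 x + form2 x) ?x ?y = polar (\<lambda>x. form1 (shift 1 0 x) + form2 (shift 0 1 x) +
    ((\<Sum>s\<in>UNIV. (cmod (x (0, 0, s)))\<^sup>2) - (\<Sum>m\<in>UNIV. (cmod (toeplitz c x (0, 0, m)))\<^sup>2))) ?x ?y"
    by (intro polar_cong form_identity) auto
  also have "\<dots> = polar form1 (shift 1 0 ?x) (shift 1 0 ?y) + polar form2 (shift 0 1 ?x) (shift 0 1 ?y) +
    ((\<Sum>r\<in>UNIV. ?x (0, 0, r) * cnj (?y (0, 0, r))) -
     (\<Sum>m\<in>UNIV. toeplitz c ?x (0, 0, m) * cnj (toeplitz c ?y (0, 0, m))))"
    unfolding polar_add_form polar_diff_form polar_sum_form polar_shift
    by (subst polar_cmod_linear polar_cmod_linear[where L = "\<lambda>u. toeplitz c u (0, 0, _)"],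
        auto simp: toeplitz_add toeplitz_diff toeplitz_scale)+
  also have "(\<Sum>r\<in>UNIV. ?x (0, 0, r) * cnj (?y (0, 0, r))) = (if i = 0 \<and> j = 0 \<and> k = 0 \<and> l = 0 \<and> s = t then 1 else 0)"
  proof -
    have "?x (0, 0, r) * cnj (?y (0, 0, r))
        = (if r = t then if i = 0 \<and> j = 0 \<and> k = 0 \<and> l = 0 \<and> s = t then 1 else 0 else 0)" for r
      by (auto simp: unit_at_def)
    then show ?thesis by simp
  qed
  finally show ?thesis
    by (simp add: form_coeff_def polar_add_form shift_unit_at toeplitz_unit_at)
qed

end

section \<open>Taylor series on the bidisk\<close>

lemma summable_on_dominated:
  fixes f :: "'a \<Rightarrow> complex"
  assumes "g summable_on A" "\<And>x. x \<in> A \<Longrightarrow> cmod (f x) \<le> g x"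
  shows "f summable_on A"
proof -
  have "(\<lambda>x. cmod (f x)) summable_on A"
    by (rule summable_on_comparison_test[OF assms(1)]) (use assms(2) in auto)
  then show ?thesis by (rule abs_summable_summable)
qed

lemma has_sum_geometric:
  fixes z :: "'a::{real_normed_field, banach}"
  assumes "norm z < 1"
  shows "((\<lambda>k. z ^ k) has_sum 1 / (1 - z)) UNIV"
  using assms by (intro norm_summable_imp_has_sum geometric_sums) (auto simp: norm_power summable_geometric)

lemma has_sum_diff:
  fixes f g :: "'a \<Rightarrow> 'b::real_normed_algebra_1"
  assumes "(f has_sum a) A" "(g has_sum b) A"
  shows "((\<lambda>x. f x - g x) has_sum (a - b)) A"
  using has_sum_add[OF assms(1) has_sum_cmult_right[OF assms(2), of "-1"]] by simp

lemma has_sum_product: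
  fixes f :: "'a \<Rightarrow> 'c::{real_normed_field, banach}" and g :: "'b \<Rightarrow> 'c"
  assumes f: "(f has_sum a) A" and g: "(g has_sum b) B"
    and fn: "(\<lambda>x. norm (f x)) summable_on A" and gn: "(\<lambda>y. norm (g y)) summable_on B"
  shows "((\<lambda>(x, y). f x * g y) has_sum a * b) (A \<times> B)"
    and "(\<lambda>(x, y). norm (f x * g y)) summable_on (A \<times> B)"
proof -
  have 1: "((\<lambda>y. case (x, y) of (x, y) \<Rightarrow> f x * g y) has_sum (f x * b)) B" for x
    using has_sum_cmult_right[OF g, of "f x"] by simp
  have 2: "((\<lambda>x. f x * b) has_sum (a * b)) A" by (rule has_sum_cmult_left[OF f])
  have 3: "((\<lambda>y. case (x, y) of (x, y) \<Rightarrow> norm (f x * g y)) has_sum (norm (f x) * infsum (\<lambda>y. norm (g y)) B)) B" for x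
    using has_sum_cmult_right[OF has_sum_infsum[OF gn], of "norm (f x)"] by (simp add: norm_mult)
  show sn: "(\<lambda>(x, y). norm (f x * g y)) summable_on (A \<times> B)"
    by (rule summable_on_SigmaI[OF 3]) (use fn in \<open>auto intro: summable_on_cmult_left\<close>)
  have "(\<lambda>(x, y). f x * g y) summable_on (A \<times> B)"
    by (rule abs_summable_summable) (use sn in \<open>simp add: case_prod_unfold\<close>)
  from has_sum_SigmaI[OF 1 2 this] show "((\<lambda>(x, y). f x * g y) has_sum a * b) (A \<times> B)" .
qed

lemma has_sum_geometric2:
  assumes "0 \<le> x" "x < 1" "0 \<le> y" "y < (1::real)"
  shows "((\<lambda>(k, l). x ^ k * y ^ l) has_sum 1 / ((1 - x) * (1 - y))) UNIV"
  using has_sum_product(1)[OF has_sum_geometric has_sum_geometric, of x y] assms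
    has_sum_imp_summable[OF has_sum_geometric[of x]] has_sum_imp_summable[OF has_sum_geometric[of y]]
  by (simp add: norm_power)

lemma taylor_unit_disk:
  assumes holo: "g holomorphic_on ball 0 1" and bound: "\<And>z. z \<in> ball 0 1 \<Longrightarrow> cmod (g z) \<le> 1"
  shows "cmod ((deriv ^^ k) g 0 / fact k) \<le> 1"
    and "z \<in> ball 0 1 \<Longrightarrow> (\<lambda>k. (deriv ^^ k) g 0 / fact k * z ^ k) sums g z"
proof -
  have "cmod ((deriv ^^ k) g 0 / fact k) * r ^ k \<le> 1" if r: "0 < r" "r < 1" for r
  proof -
    have "cmod ((deriv ^^ k) g 0) \<le> fact k * 1 / r ^ k"
    proof (rule Cauchy_inequality)
      show "g holomorphic_on ball 0 r" "continuous_on (cball 0 r) g"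
        using r by (auto intro!: holomorphic_on_imp_continuous_on holomorphic_on_subset[OF holo])
    qed (use r bound in auto)
    then show ?thesis using r by (simp add: norm_divide field_simps)
  qed
  then have "eventually (\<lambda>r. cmod ((deriv ^^ k) g 0 / fact k) * r ^ k \<le> 1) (at_left (1::real))"
    using eventually_at_left_real[of 0 1] by (auto elim!: eventually_mono)
  moreover have "((\<lambda>r. cmod ((deriv ^^ k) g 0 / fact k) * r ^ k) \<longlongrightarrow> cmod ((deriv ^^ k) g 0 / fact k) * 1 ^ k) (at_left 1)"
    by (intro tendsto_intros)
  ultimately show "cmod ((deriv ^^ k) g 0 / fact k) \<le> 1"
    using tendsto_upperbound[of _ _ "at_left (1::real)" 1] by simp
  show "z \<in> ball 0 1 \<Longrightarrow> (\<lambda>k. (deriv ^^ k) g 0 / fact k * z ^ k) sums g z"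
    using holomorphic_power_series[OF holo] by simp
qed

lemma power_series_remainder_le:
  fixes e :: "nat \<Rightarrow> complex"
  assumes e: "\<And>k. cmod (e k) \<le> 1" and s: "(\<lambda>k. e k * z ^ k) sums v" and z: "cmod z \<le> 1 / 2"
  shows "cmod (v - (\<Sum>j<k. e j * z ^ j)) \<le> 2 * cmod z ^ k"
proof -
  have "(\<lambda>j. e (j + k) * z ^ (j + k)) sums (v - (\<Sum>j<k. e j * z ^ j))"
    using sums_split_initial_segment[OF s, of k] by simp
  moreover have "(\<lambda>j. cmod z ^ k * cmod z ^ j) sums (cmod z ^ k * (1 / (1 - cmod z)))"
    using z by (intro sums_mult geometric_sums) auto
  moreover have "cmod (e (j + k) * z ^ (j + k)) \<le> cmod z ^ k * cmod z ^ j" for j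
    using mult_right_mono[OF e[of "j + k"], of "cmod z ^ (j + k)"]
    by (simp add: norm_mult norm_power power_add mult.commute)
  ultimately have "cmod (v - (\<Sum>j<k. e j * z ^ j)) \<le> cmod z ^ k * (1 / (1 - cmod z))"
    by (metis (no_types, lifting) norm_suminf_le sums_iff)
  also have "\<dots> \<le> cmod z ^ k * 2" using z by (intro mult_left_mono) (auto simp: field_simps)
  finally show ?thesis by simp
qed

text \<open>
The coefficient of index \<open>k\<close> is the limit for \<open>t \<longlonglongrightarrow> 0\<close> of the Taylor
remainder of order \<open>k\<close> at \<open>t\<close>, divided by \<open>t ^ k\<close>. The remainder involves earlier coefficients only,
so it is holomorphic in \<open>w\<close> by induction, and the bound on \<open>F\<close> makes the limit uniform in \<open>w\<close>.
\<close>

lemma taylor_coefficient_holomorphic: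
  fixes F :: "complex \<Rightarrow> complex \<Rightarrow> complex"
  assumes holo1: "\<And>w. w \<in> ball 0 1 \<Longrightarrow> (\<lambda>z. F z w) holomorphic_on ball 0 1"
    and holo2: "\<And>z. z \<in> ball 0 1 \<Longrightarrow> F z holomorphic_on ball 0 1"
    and bound: "\<And>z w. z \<in> ball 0 1 \<Longrightarrow> w \<in> ball 0 1 \<Longrightarrow> cmod (F z w) \<le> 1"
  shows "(\<lambda>w. (deriv ^^ k) (\<lambda>z. F z w) 0 / fact k) holomorphic_on ball 0 1"
proof (induction k rule: less_induct)
  case (less k)
  define e where "e j w = (deriv ^^ j) (\<lambda>z. F z w) 0 / fact j" for j w
  define t :: "nat \<Rightarrow> complex" where "t n = of_real (1 / (real n + 2))" for n
  define g where "g n w = (F (t n) w - (\<Sum>j<k. e j w * t n ^ j)) / t n ^ k" for n w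
  have t: "cmod (t n) = 1 / (real n + 2)" for n unfolding t_def norm_of_real by simp
  have t0: "t n \<noteq> 0" for n
  proof -
    have "cmod (t n) > 0" by (simp add: t add_pos_nonneg)
    then show ?thesis by auto
  qed
  have t12: "cmod (t n) \<le> 1 / 2" for n by (simp add: t divide_simps)
  have t1: "t n \<in> ball 0 1" for n using t12[of n] by simp
  have e: "e j holomorphic_on ball 0 1" if "j < k" for j using less[OF that] by (simp add: e_def [abs_def])
  have dist: "cmod (g n w - e k w) \<le> 2 / (real n + 2)" if w: "w \<in> ball 0 1" for n w
  proof -
    have rem: "cmod (F (t n) w - (\<Sum>j<Suc k. e j w * t n ^ j)) \<le> 2 * cmod (t n) ^ Suc k"
      unfolding e_def using t12 t1 taylor_unit_disk[OF holo1[OF w] bound[OF _ w]]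
      by (intro power_series_remainder_le) auto
    have eq: "g n w - e k w = (F (t n) w - (\<Sum>j<Suc k. e j w * t n ^ j)) / t n ^ k"
      using t0 by (simp add: g_def field_simps)
    have "cmod (g n w - e k w) \<le> 2 * cmod (t n) ^ Suc k / cmod (t n) ^ k"
      unfolding eq norm_divide norm_power by (intro divide_right_mono rem) simp
    then show ?thesis using t0[of n] by (simp add: t)
  qed
  have unif: "uniform_limit (ball 0 1) g (e k) sequentially"
  proof (rule uniform_limitI)
    fix \<epsilon> :: real assume "0 < \<epsilon>"
    have "(\<lambda>n. 2 / (real n + 2)) \<longlonglongrightarrow> 0" by real_asymp
    then have "eventually (\<lambda>n. 2 / (real n + 2) < \<epsilon>) sequentially"
      using \<open>0 < \<epsilon>\<close> by (rule order_tendstoD)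
    then show "\<forall>\<^sub>F n in sequentially. \<forall>w\<in>ball 0 1. dist (g n w) (e k w) < \<epsilon>"
      by eventually_elim (auto simp: dist_norm intro: le_less_trans[OF dist])
  qed
  have "e k holomorphic_on ball 0 1"
  proof (rule holomorphic_uniform_sequence)
    show "g n holomorphic_on ball 0 1" for n
      unfolding g_def using t0 t1 by (intro holomorphic_intros holo2 e) auto
    fix x :: complex assume "x \<in> ball 0 1"
    then obtain d where "0 < d" "cball x d \<subseteq> ball 0 1" using open_contains_cball[of "ball 0 1"] by blast
    then show "\<exists>d>0. cball x d \<subseteq> ball 0 1 \<and> uniform_limit (cball x d) g (e k) sequentially"
      using uniform_limit_on_subset[OF unif] by blast
  qed auto
  then show ?case by (simp add: e_def [abs_def])
qed

text \<open>
Expand in the first variable, then each coefficient in the second; the Cauchy estimates bound all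
coefficients by 1 and make the double series absolutely convergent.
\<close>

lemma taylor_unit_bidisk:
  fixes F :: "complex \<Rightarrow> complex \<Rightarrow> complex"
  assumes holo1: "\<And>w. w \<in> ball 0 1 \<Longrightarrow> (\<lambda>z. F z w) holomorphic_on ball 0 1"
    and holo2: "\<And>z. z \<in> ball 0 1 \<Longrightarrow> F z holomorphic_on ball 0 1"
    and bound: "\<And>z w. z \<in> ball 0 1 \<Longrightarrow> w \<in> ball 0 1 \<Longrightarrow> cmod (F z w) \<le> 1"
  shows "\<exists>c. (\<forall>k l. cmod (c k l) \<le> 1) \<and>
     (\<forall>z\<in>ball 0 1. \<forall>w\<in>ball 0 1. ((\<lambda>(k, l). c k l * z ^ k * w ^ l) has_sum F z w) UNIV)"
proof -
  define e where "e j w = (deriv ^^ j) (\<lambda>z. F z w) 0 / fact j" for j w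
  define c where "c k l = (deriv ^^ l) (e k) 0 / fact l" for k l
  have taylor1: "cmod (e k w) \<le> 1" "v \<in> ball 0 1 \<Longrightarrow> (\<lambda>k. e k w * v ^ k) sums F v w"
    if "w \<in> ball 0 1" for k v w
    unfolding e_def using taylor_unit_disk[of "\<lambda>z. F z w", OF holo1[OF that] bound[OF _ that]] by blast+
  have e: "e k holomorphic_on ball 0 1" for k
    using taylor_coefficient_holomorphic[of F k, OF assms] by (simp add: e_def [abs_def])
  have taylor2: "cmod (c k l) \<le> 1" "v \<in> ball 0 1 \<Longrightarrow> (\<lambda>l. c k l * v ^ l) sums e k v" for k l v
    unfolding c_def using taylor_unit_disk[of "e k", OF e taylor1(1)] by blast+
  have "((\<lambda>(k, l). c k l * z ^ k * w ^ l) has_sum F z w) UNIV" if z: "z \<in> ball 0 1" and w: "w \<in> ball 0 1" for z w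
  proof -
    have "((\<lambda>l. c k l * w ^ l) has_sum e k w) UNIV" for k
    proof (rule norm_summable_imp_has_sum)
      show "summable (\<lambda>l. cmod (c k l * w ^ l))"
        using taylor2(1)[of k] w
        by (intro summable_comparison_test'[of "\<lambda>l. cmod w ^ l" 0 "\<lambda>l. cmod (c k l * w ^ l)"])
           (auto simp: norm_mult norm_power mult_left_le_one_le)
    qed (rule taylor2(2)[OF w])
    then have 1: "((\<lambda>l. case (k, l) of (k, l) \<Rightarrow> c k l * z ^ k * w ^ l) has_sum (e k w * z ^ k)) UNIV" for k
      using has_sum_cmult_left[of "\<lambda>l. c k l * w ^ l" UNIV "e k w" "z ^ k"] by (simp add: mult_ac)
    have 2: "((\<lambda>k. e k w * z ^ k) has_sum F z w) UNIV"
    proof (rule norm_summable_imp_has_sum)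
      show "summable (\<lambda>k. cmod (e k w * z ^ k))"
        using taylor1(1)[OF w] z
        by (intro summable_comparison_test'[of "\<lambda>l. cmod z ^ l" 0 "\<lambda>k. cmod (e k w * z ^ k)"])
           (auto simp: norm_mult norm_power mult_left_le_one_le)
    qed (rule taylor1(2)[OF w z])
    have "(\<lambda>(k, l). c k l * z ^ k * w ^ l) summable_on UNIV \<times> UNIV"
    proof (rule summable_on_dominated)
      show "(\<lambda>(k, l). cmod z ^ k * cmod w ^ l) summable_on UNIV \<times> UNIV"
        using has_sum_imp_summable[OF has_sum_geometric2[of "cmod z" "cmod w"]] z w by simp
    qed (use taylor2(1) in \<open>auto simp: norm_mult norm_power mult.assoc mult_left_le_one_le\<close>)
    from has_sum_SigmaI[OF 1 2 this] show ?thesis by simp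
  qed
  moreover have "cmod (c k l) \<le> 1" for k l using taylor2(1) by simp
  ultimately show ?thesis by blast
qed

section \<open>Contractivity of the Toeplitz operator of a Schur function\<close>

lemma has_sum_finite_sum:
  fixes f :: "'i \<Rightarrow> 'a \<Rightarrow> 'b::topological_comm_monoid_add"
  assumes "\<And>i. i \<in> I \<Longrightarrow> (f i has_sum s i) A"
  shows "((\<lambda>x. \<Sum>i\<in>I. f i x) has_sum (\<Sum>i\<in>I. s i)) A"
  using assms by (induction I rule: infinite_finite_induct) (simp_all add: has_sum_0 has_sum_add)

lemma orthogonal_parseval:
  assumes S: "finite S"
    and orth: "\<And>p q. p \<in> S \<Longrightarrow> q \<in> S \<Longrightarrow> (\<Sum>x\<in>A. e p x * cnj (e q x)) = (if p = q then of_real N else 0)"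
  shows "(\<Sum>x\<in>A. (cmod (\<Sum>p\<in>S. u p * e p x))\<^sup>2) = N * (\<Sum>p\<in>S. (cmod (u p))\<^sup>2)"
proof -
  have "complex_of_real (\<Sum>x\<in>A. (cmod (\<Sum>p\<in>S. u p * e p x))\<^sup>2)
      = (\<Sum>x\<in>A. \<Sum>p\<in>S. \<Sum>q\<in>S. u p * cnj (u q) * (e p x * cnj (e q x)))"
    unfolding of_real_sum complex_norm_square
    by (intro sum.cong refl) (simp add: sum_product mult_ac)
  also have "\<dots> = (\<Sum>p\<in>S. \<Sum>x\<in>A. \<Sum>q\<in>S. u p * cnj (u q) * (e p x * cnj (e q x)))"
    by (rule sum.swap)
  also have "\<dots> = (\<Sum>p\<in>S. \<Sum>q\<in>S. \<Sum>x\<in>A. u p * cnj (u q) * (e p x * cnj (e q x)))"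
    by (intro sum.cong refl sum.swap)
  also have "\<dots> = (\<Sum>p\<in>S. \<Sum>q\<in>S. u p * cnj (u q) * (if p = q then of_real N else 0))"
    by (intro sum.cong refl) (simp add: orth sum_distrib_left[symmetric])
  also have "\<dots> = (\<Sum>p\<in>S. of_real N * (u p * cnj (u p)))"
    using S by (intro sum.cong refl) (simp add: if_distrib mult_ac cong: if_cong)
  also have "\<dots> = complex_of_real (N * (\<Sum>p\<in>S. (cmod (u p))\<^sup>2))"
    by (simp only: sum_distrib_left[symmetric] complex_norm_square[symmetric] of_real_sum[symmetric] of_real_mult)
  finally show ?thesis by (simp only: of_real_eq_iff)
qed

text \<open>
Expand \<open>\<parallel>N W - g\<parallel>\<^sup>2 \<ge> 0\<close>, where \<open>g / N\<close> is the orthogonal projection of \<open>W\<close> to the span of the system.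
\<close>

lemma orthogonal_bessel:
  assumes S: "finite S" and N: "0 < N"
    and orth: "\<And>p q. p \<in> S \<Longrightarrow> q \<in> S \<Longrightarrow> (\<Sum>x\<in>A. e p x * cnj (e q x)) = (if p = q then of_real N else 0)"
  shows "(\<Sum>p\<in>S. (cmod (\<Sum>x\<in>A. W x * cnj (e p x)))\<^sup>2) \<le> N * (\<Sum>x\<in>A. (cmod (W x))\<^sup>2)"
proof -
  define w where "w p = (\<Sum>x\<in>A. W x * cnj (e p x))" for p
  define g where "g x = (\<Sum>p\<in>S. w p * e p x)" for x
  let ?w = "\<Sum>p\<in>S. (cmod (w p))\<^sup>2"
  have gg: "(\<Sum>x\<in>A. (cmod (g x))\<^sup>2) = N * ?w"
    unfolding g_def by (rule orthogonal_parseval[OF S orth])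
  have "(\<Sum>x\<in>A. W x * cnj (g x)) = (\<Sum>x\<in>A. \<Sum>p\<in>S. cnj (w p) * (W x * cnj (e p x)))"
    by (intro sum.cong refl) (simp add: g_def sum_distrib_left mult_ac)
  also have "\<dots> = (\<Sum>p\<in>S. \<Sum>x\<in>A. cnj (w p) * (W x * cnj (e p x)))" by (rule sum.swap)
  also have "\<dots> = (\<Sum>p\<in>S. w p * cnj (w p))"
    by (simp only: sum_distrib_left[symmetric] w_def[symmetric]) (simp only: mult.commute)
  also have "\<dots> = complex_of_real ?w" by (simp only: complex_norm_square of_real_sum)
  finally have Wg: "(\<Sum>x\<in>A. Re (W x * cnj (g x))) = ?w"
    unfolding Re_sum[symmetric] by simp
  have expand: "(cmod (of_real N * W x - g x))\<^sup>2
      = N\<^sup>2 * (cmod (W x))\<^sup>2 - 2 * N * Re (W x * cnj (g x)) + (cmod (g x))\<^sup>2" for x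
    unfolding cmod_power2 by (simp add: power2_eq_square algebra_simps)
  have "0 \<le> (\<Sum>x\<in>A. (cmod (of_real N * W x - g x))\<^sup>2)" by (rule sum_nonneg) simp
  also have "\<dots> = N\<^sup>2 * (\<Sum>x\<in>A. (cmod (W x))\<^sup>2) - 2 * N * ?w + N * ?w"
    unfolding expand by (simp only: sum.distrib sum_subtractf sum_distrib_left[symmetric] Wg gg)
  also have "\<dots> = N * (N * (\<Sum>x\<in>A. (cmod (W x))\<^sup>2) - ?w)"
    by (simp add: power2_eq_square algebra_simps)
  finally show ?thesis using N by (simp add: zero_le_mult_iff w_def)
qed

lemma sum_cis_roots:
  assumes "0 < n"
  shows "(\<Sum>a<n. cis (2 * pi * of_int d * real a / real n)) = (if int n dvd d then of_nat n else 0)"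
proof -
  define \<omega> where "\<omega> = cis (2 * pi * of_int d / real n)"
  have "(\<Sum>a<n. cis (2 * pi * of_int d * real a / real n)) = (\<Sum>a<n. \<omega> ^ a)"
    by (intro sum.cong refl) (simp add: \<omega>_def Complex.DeMoivre field_simps)
  also have "\<dots> = (if int n dvd d then of_nat n else 0)"
  proof (cases "int n dvd d")
    case True
    then obtain q where "d = int n * q" by (auto elim: dvdE)
    then have "2 * pi * of_int d / real n = 2 * pi * of_int q" using assms by simp
    then have "\<omega> = 1" by (simp only: \<omega>_def cis_multiple_2pi Ints_of_int)
    then show ?thesis using True by simp
  next
    case False
    have "\<omega> \<noteq> 1"
    proof
      assume "\<omega> = 1"
      then obtain q :: int where "2 * pi * of_int d / real n = of_int q * 2 * pi"
        unfolding \<omega>_def cis_conv_exp exp_eq_1 by auto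
      then have "real_of_int d = of_int (q * int n)" using assms by (simp add: field_simps)
      then have "d = q * int n" by (simp only: of_int_eq_iff)
      with False show False by simp
    qed
    moreover have "\<omega> ^ n = 1"
    proof -
      have e: "real n * (2 * pi * of_int d / real n) = 2 * pi * of_int d" using assms by simp
      show ?thesis by (simp only: \<omega>_def Complex.DeMoivre e cis_multiple_2pi Ints_of_int)
    qed
    ultimately show ?thesis using False by (simp add: geometric_sum)
  qed
  finally show ?thesis .
qed

text \<open>
The characters of the product of two cyclic groups of order \<open>n\<close>, indexed by integers, which matter
only modulo \<open>n\<close>.
\<close>

definition torus_char :: "nat \<Rightarrow> int \<Rightarrow> int \<Rightarrow> nat \<times> nat \<Rightarrow> complex" where
  "torus_char n i j = (\<lambda>(a, b). cis (2 * pi * of_int i * real a / real n) * cis (2 * pi * of_int j * real b / real n))"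

lemma torus_char_mult: "torus_char n i j x * torus_char n k l x = torus_char n (i + k) (j + l) x"
proof (cases x)
  case (Pair a b)
  have "torus_char n i j x * torus_char n k l x = 
     (cis (2 * pi * of_int i * real a / real n) * cis (2 * pi * of_int k * real a / real n)) *
     (cis (2 * pi * of_int j * real b / real n) * cis (2 * pi * of_int l * real b / real n))"
    by (simp add: torus_char_def Pair mult_ac)
  also have "\<dots> = torus_char n (i + k) (j + l) x"
    unfolding cis_mult torus_char_def Pair prod.case by (simp add: algebra_simps add_divide_distrib)
  finally show ?thesis .
qed

lemma torus_char_cnj: "cnj (torus_char n i j x) = torus_char n (- i) (- j) x"
  by (cases x) (simp add: torus_char_def cis_cnj)

lemma sum_torus_char:
  assumes "0 < n"
  shows "(\<Sum>x\<in>{..<n}\<times>{..<n}. torus_char n i j x) = (if int n dvd i \<and> int n dvd j then (of_nat n)\<^sup>2 else 0)"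
proof -
  have "(\<Sum>x\<in>{..<n}\<times>{..<n}. torus_char n i j x) =
     (\<Sum>a<n. cis (2 * pi * of_int i * real a / real n)) * (\<Sum>b<n. cis (2 * pi * of_int j * real b / real n))"
    by (simp add: torus_char_def sum_product sum.cartesian_product)
  then show ?thesis using assms by (simp add: sum_cis_roots power2_eq_square)
qed

text \<open>
In a box of side less than \<open>n\<close>, distinct indices are distinct modulo \<open>n\<close>.
\<close>

lemma torus_char_orthogonal:
  assumes "2 * K < int n" "p \<in> {-K..K} \<times> {-K..K}" "q \<in> {-K..K} \<times> {-K..K}"
  shows "(\<Sum>x\<in>{..<n}\<times>{..<n}. torus_char n (fst p) (snd p) x * cnj (torus_char n (fst q) (snd q) x))
     = (if p = q then complex_of_real ((real n)\<^sup>2) else 0)"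
proof -
  have n: "0 < n" using assms by auto
  have dvd: "int n dvd i - k \<longleftrightarrow> i = k" if "i \<in> {-K..K}" "k \<in> {-K..K}" for i k
  proof
    assume "int n dvd i - k"
    then have "i - k = 0 \<or> int n \<le> \<bar>i - k\<bar>" using dvd_imp_le_int[of "i - k" "int n"] by auto
    then show "i = k" using that assms(1) by auto
  qed auto
  show ?thesis
    unfolding torus_char_cnj torus_char_mult sum_torus_char[OF n]
    using dvd[of "fst p" "fst q"] dvd[of "snd p" "snd q"] assms(2,3)
    by (cases p; cases q) auto
qed

text \<open>
Averaging \<open>g\<close> against a character over the \<open>n\<close>-th roots of unity picks out all coefficients of \<open>g\<close> whose
index is congruent to \<open>(d, e)\<close> modulo \<open>n\<close>. Except for the index \<open>(d, e)\<close> itself these have total degree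
about \<open>n\<close> or more, and their sum tends to 0 on a torus of radius less than 1. The radius is written as a
square so that half of the powers of \<open>\<rho>\<close> bounds the terms by a null sequence and the other half keeps
the series summable.
\<close>

lemma discrete_fourier_tendsto:
  fixes b :: "nat \<Rightarrow> nat \<Rightarrow> complex"
  assumes sums: "\<And>z w. z \<in> ball 0 1 \<Longrightarrow> w \<in> ball 0 1 \<Longrightarrow> ((\<lambda>(k, l). b k l * z ^ k * w ^ l) has_sum g z w) UNIV"
    and bound: "\<And>k l. cmod (b k l) \<le> 1" and \<rho>: "0 < \<rho>" "\<rho> < 1"
  shows "(\<lambda>n. (\<Sum>x\<in>{..<n}\<times>{..<n}. g (of_real (\<rho>\<^sup>2) * torus_char n (-1) 0 x) (of_real (\<rho>\<^sup>2) * torus_char n 0 (-1) x)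
        * torus_char n d e x) / (of_nat n)\<^sup>2)
     \<longlonglongrightarrow> (if 0 \<le> d \<and> 0 \<le> e then b (nat d) (nat e) * of_real (\<rho>\<^sup>2) ^ (nat d + nat e) else 0)"
    (is "?avg \<longlonglongrightarrow> ?T")
proof -
  define H where "H n = (\<lambda>(k, l). b k l * of_real (\<rho>\<^sup>2) ^ (k + l) *
     (if int n dvd d - int k \<and> int n dvd e - int l then 1 else 0))" for n
  define G where "G = (\<lambda>(k, l). if int k = d \<and> int l = e then b k l * of_real (\<rho>\<^sup>2) ^ (k + l) else 0)"
  have char_power: "torus_char n i j x ^ k = torus_char n (int k * i) (int k * j) x" for n i j x k
    by (induction k) (auto simp: torus_char_mult algebra_simps, simp add: torus_char_def case_prod_unfold)
  have r2: "\<rho>\<^sup>2 < 1" using \<rho> by (simp add: power_less_one_iff abs_square_less_1)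
  have "cmod (torus_char n i j x) = 1" for n i j x by (cases x) (simp add: torus_char_def norm_mult)
  then have in_disk: "of_real (\<rho>\<^sup>2) * torus_char n i j x \<in> ball 0 1" for n i j x
    using r2 by (simp add: norm_mult norm_power)
  have H: "(H n has_sum ?avg n) UNIV" if n: "0 < n" for n
  proof -
    let ?term = "\<lambda>x. (\<lambda>(k, l). b k l * of_real (\<rho>\<^sup>2) ^ (k + l) * torus_char n (d - int k) (e - int l) x)"
    have "(?term x has_sum (g (of_real (\<rho>\<^sup>2) * torus_char n (-1) 0 x) (of_real (\<rho>\<^sup>2) * torus_char n 0 (-1) x)
        * torus_char n d e x)) UNIV" for x
    proof -
      have "?term x = (\<lambda>y. (case y of (k, l) \<Rightarrow> b k l * (of_real (\<rho>\<^sup>2) * torus_char n (-1) 0 x) ^ k *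
          (of_real (\<rho>\<^sup>2) * torus_char n 0 (-1) x) ^ l) * torus_char n d e x)"
      proof (rule ext, clarify)
        fix k l
        have "torus_char n (d - int k) (e - int l) x = torus_char n (-1) 0 x ^ k * torus_char n 0 (-1) x ^ l * torus_char n d e x"
          unfolding char_power torus_char_mult by simp
        then show "b k l * of_real (\<rho>\<^sup>2) ^ (k + l) * torus_char n (d - int k) (e - int l) x =
          b k l * (of_real (\<rho>\<^sup>2) * torus_char n (-1) 0 x) ^ k *
          (of_real (\<rho>\<^sup>2) * torus_char n 0 (-1) x) ^ l * torus_char n d e x"
          by (simp add: power_add power_mult_distrib)
      qed
      then show ?thesis using has_sum_cmult_left[OF sums[OF in_disk in_disk]] by simp
    qed
    then have "((\<lambda>y. \<Sum>x\<in>{..<n}\<times>{..<n}. ?term x y) has_sum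
        (\<Sum>x\<in>{..<n}\<times>{..<n}. g (of_real (\<rho>\<^sup>2) * torus_char n (-1) 0 x) (of_real (\<rho>\<^sup>2) * torus_char n 0 (-1) x)
        * torus_char n d e x)) UNIV"
      by (intro has_sum_finite_sum) auto
    from has_sum_cmult_left[OF this, of "1 / (of_nat n)\<^sup>2"]
    have "((\<lambda>y. (\<Sum>x\<in>{..<n}\<times>{..<n}. ?term x y) / (of_nat n)\<^sup>2) has_sum ?avg n) UNIV" by simp
    also have "(\<lambda>y. (\<Sum>x\<in>{..<n}\<times>{..<n}. ?term x y) / (of_nat n)\<^sup>2) = H n"
    proof
      fix y :: "nat \<times> nat"
      show "(\<Sum>x\<in>{..<n}\<times>{..<n}. ?term x y) / (of_nat n)\<^sup>2 = H n y"
        using n by (cases y) (simp add: sum_distrib_left[symmetric] sum_torus_char H_def)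
    qed
    finally show ?thesis .
  qed
  have G: "(G has_sum ?T) UNIV"
  proof (cases "0 \<le> d \<and> 0 \<le> e")
    case True
    then have "(G has_sum (\<Sum>y\<in>{(nat d, nat e)}. G y)) {(nat d, nat e)}" by (intro has_sum_finite) auto
    also have "?this \<longleftrightarrow> (G has_sum (\<Sum>y\<in>{(nat d, nat e)}. G y)) UNIV"
      using True by (intro has_sum_cong_neutral) (auto simp: G_def split: if_splits)
    finally show ?thesis using True by (simp add: G_def)
  next
    case False
    then have "G = (\<lambda>_. 0)" by (auto simp: G_def)
    then show ?thesis using False by (auto simp: has_sum_0)
  qed
  have "cmod (?avg n - ?T) \<le> \<rho> ^ nat (int n - \<bar>d\<bar> - \<bar>e\<bar>) * (1 / ((1 - \<rho>) * (1 - \<rho>)))" if n: "0 < n" for n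
  proof (rule norm_infsum_le)
    let ?N = "nat (int n - \<bar>d\<bar> - \<bar>e\<bar>)"
    show "((\<lambda>y. H n y - G y) has_sum (?avg n - ?T)) UNIV" by (rule has_sum_diff[OF H[OF n] G])
    show "((\<lambda>y. \<rho> ^ ?N * (case y of (k, l) \<Rightarrow> \<rho> ^ k * \<rho> ^ l)) has_sum (\<rho> ^ ?N * (1 / ((1 - \<rho>) * (1 - \<rho>))))) UNIV"
      using \<rho> by (intro has_sum_cmult_right has_sum_geometric2) auto
    fix y :: "nat \<times> nat"
    obtain k l where y: "y = (k, l)" by (cases y)
    have *: "cmod (b k l * of_real (\<rho>\<^sup>2) ^ (k + l)) \<le> \<rho> ^ ?N * (\<rho> ^ k * \<rho> ^ l)" if "?N \<le> k + l"
    proof -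
      have "cmod (b k l * of_real (\<rho>\<^sup>2) ^ (k + l)) \<le> 1 * (\<rho>\<^sup>2) ^ (k + l)"
        unfolding norm_mult norm_power norm_of_real using bound \<rho> by (intro mult_mono) auto
      also have "\<dots> = \<rho> ^ (k + l) * (\<rho> ^ k * \<rho> ^ l)"
        by (simp add: power_add power_mult_distrib power2_eq_square)
      also have "\<dots> \<le> \<rho> ^ ?N * (\<rho> ^ k * \<rho> ^ l)"
        using \<rho> that by (intro mult_right_mono power_decreasing) auto
      finally show ?thesis .
    qed
    have "?N \<le> k + l" if "int n dvd d - int k" "int n dvd e - int l" "\<not> (int k = d \<and> int l = e)"
    proof -
      have "d = int k \<or> int n \<le> \<bar>d - int k\<bar>" "e = int l \<or> int n \<le> \<bar>e - int l\<bar>"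
        using that dvd_imp_le_int[of "d - int k" "int n"] dvd_imp_le_int[of "e - int l" "int n"] by auto
      then show ?thesis using that(3) by linarith
    qed
    then show "cmod (H n y - G y) \<le> \<rho> ^ ?N * (case y of (k, l) \<Rightarrow> \<rho> ^ k * \<rho> ^ l)"
      using * \<rho> unfolding y H_def G_def by auto
  qed
  then have "eventually (\<lambda>n. norm (?avg n - ?T) \<le> \<rho> ^ nat (int n - \<bar>d\<bar> - \<bar>e\<bar>) * (1 / ((1 - \<rho>) * (1 - \<rho>)))) sequentially"
    using eventually_gt_at_top[of 0] by (rule eventually_mono[rotated])
  moreover have "(\<lambda>n. \<rho> ^ nat (int n - \<bar>d\<bar> - \<bar>e\<bar>) * (1 / ((1 - \<rho>) * (1 - \<rho>)))) \<longlonglongrightarrow> 0"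
  proof (rule tendsto_mult_left_zero)
    have "filterlim (\<lambda>n. nat (int n - \<bar>d\<bar> - \<bar>e\<bar>)) sequentially sequentially"
      unfolding filterlim_at_top
    proof
      fix Z show "eventually (\<lambda>n. Z \<le> nat (int n - \<bar>d\<bar> - \<bar>e\<bar>)) sequentially"
        using eventually_ge_at_top[of "Z + nat \<bar>d\<bar> + nat \<bar>e\<bar>"] by eventually_elim auto
    qed
    then show "(\<lambda>n. \<rho> ^ nat (int n - \<bar>d\<bar> - \<bar>e\<bar>)) \<longlonglongrightarrow> 0"
      using \<rho> by (intro filterlim_compose[OF LIMSEQ_realpow_zero]) auto
  qed
  ultimately have "(\<lambda>n. ?avg n - ?T) \<longlonglongrightarrow> 0" by (rule Lim_null_comparison)
  then show ?thesis by (rule LIM_zero_cancel)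
qed

text \<open>
On the group of pairs of \<open>n\<close>-th roots of unity, Parseval for \<open>u\<close>, the pointwise bound for \<open>f\<close> on a torus of
radius \<open>\<rho>\<^sup>2\<close> and Bessel for the product show that the Toeplitz matrix of discrete Fourier coefficients
of \<open>f\<close> is a contraction on sequences supported in a fixed box \<open>B\<close>. Its entries converge for
\<open>n \<longlonglongrightarrow> \<infinity>\<close>, and then for \<open>\<rho> \<longlonglongrightarrow> 1\<close>, to the Taylor coefficients.
\<close>

lemma toeplitz_contractive:
  fixes f :: "complex \<Rightarrow> complex \<Rightarrow> 'm::finite \<Rightarrow> 'n::finite \<Rightarrow> complex"
    and c :: "nat \<Rightarrow> nat \<Rightarrow> 'm \<Rightarrow> 'n \<Rightarrow> complex"
  assumes sums: "\<And>z w m s. z \<in> ball 0 1 \<Longrightarrow> w \<in> ball 0 1 \<Longrightarrow>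
      ((\<lambda>(k, l). c k l m s * z ^ k * w ^ l) has_sum f z w m s) UNIV"
    and bound: "\<And>k l m s. cmod (c k l m s) \<le> 1"
    and contr: "\<And>z w x. z \<in> ball 0 1 \<Longrightarrow> w \<in> ball 0 1 \<Longrightarrow>
      (\<Sum>m\<in>UNIV. (cmod (\<Sum>s\<in>UNIV. f z w m s * x s))\<^sup>2) \<le> (\<Sum>s\<in>UNIV. (cmod (x s))\<^sup>2)"
    and u: "finsupp u" and F: "finite F"
  shows "(\<Sum>y\<in>F. (cmod (toeplitz (\<lambda>i j m s. if 0 \<le> i \<and> 0 \<le> j then c (nat i) (nat j) m s else 0) u y))\<^sup>2)
    \<le> sqnorm u"
proof -
  define C where "C i j m s = (if 0 \<le> i \<and> 0 \<le> j then c (nat i) (nat j) m s else 0)" for i j m s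
  \<comment> \<open>The box \<open>B\<close> of radius \<open>K\<close> contains the support of \<open>u\<close> and all positions in \<open>F\<close>.\<close>
  define K where "K = (\<Sum>(i, j, s) | u (i, j, s) \<noteq> 0. \<bar>i\<bar> + \<bar>j\<bar>) + (\<Sum>(i, j, m)\<in>F. \<bar>i\<bar> + \<bar>j\<bar>)"
  define B where "B = {-K..K} \<times> {-K..K}"
  define uB where "uB s q = u (fst q, snd q, s)" for s q
  have B: "finite B" by (simp add: B_def)
  have uK: "(i, j) \<in> B" if "u (i, j, s) \<noteq> 0" for i j s
  proof -
    have "finite {(i, j, s). u (i, j, s) \<noteq> 0}" using u by (simp add: finsupp_def case_prod_unfold)
    from member_le_sum[OF _ _ this, of "(i, j, s)" "\<lambda>(i, j, s). \<bar>i\<bar> + \<bar>j\<bar>"] that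
    have "\<bar>i\<bar> + \<bar>j\<bar> \<le> (\<Sum>(i, j, s) | u (i, j, s) \<noteq> 0. \<bar>i\<bar> + \<bar>j\<bar>)" by force
    moreover have "0 \<le> (\<Sum>(i, j, m)\<in>F. \<bar>i\<bar> + \<bar>j\<bar>)" by (rule sum_nonneg) auto
    ultimately show ?thesis by (auto simp: B_def K_def)
  qed
  have FK: "(i, j) \<in> B" if "(i, j, m) \<in> F" for i j m
  proof -
    from member_le_sum[OF _ _ F, of "(i, j, m)" "\<lambda>(i, j, s). \<bar>i\<bar> + \<bar>j\<bar>"] that
    have "\<bar>i\<bar> + \<bar>j\<bar> \<le> (\<Sum>(i, j, m)\<in>F. \<bar>i\<bar> + \<bar>j\<bar>)" by force
    moreover have "0 \<le> (\<Sum>(i, j, s) | u (i, j, s) \<noteq> 0. \<bar>i\<bar> + \<bar>j\<bar>)" by (rule sum_nonneg) auto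
    ultimately show ?thesis by (auto simp: B_def K_def)
  qed
  define R where "R = (\<Sum>s\<in>UNIV. \<Sum>q\<in>B. (cmod (uB s q))\<^sup>2)"
  define L where "L X = (\<Sum>m\<in>UNIV. \<Sum>p\<in>B. (cmod (\<Sum>s\<in>UNIV. \<Sum>q\<in>B. X (fst q - fst p) (snd q - snd p) m s * uB s q))\<^sup>2)"
    for X :: "int \<Rightarrow> int \<Rightarrow> 'm \<Rightarrow> 'n \<Rightarrow> complex"
  have "L (\<lambda>d e m s. C d e m s * of_real (\<rho>\<^sup>2) ^ (nat d + nat e)) \<le> R" if \<rho>: "0 < \<rho>" "\<rho> < 1" for \<rho>
  proof -
    define Z where "Z n x = of_real (\<rho>\<^sup>2) * torus_char n (-1) 0 x" for n x
    define V where "V n x = of_real (\<rho>\<^sup>2) * torus_char n 0 (-1) x" for n x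
    define avg where "avg n d e m s = (\<Sum>x\<in>{..<n}\<times>{..<n}. f (Z n x) (V n x) m s * torus_char n d e x) / (of_nat n)\<^sup>2"
      for n d e m s
    have r2: "\<rho>\<^sup>2 < 1" using \<rho> by (simp add: power_less_one_iff abs_square_less_1)
    have "cmod (torus_char n i j x) = 1" for n i j x by (cases x) (simp add: torus_char_def norm_mult)
    then have ZV: "Z n x \<in> ball 0 1" "V n x \<in> ball 0 1" for n x
      using r2 by (simp_all add: Z_def V_def norm_mult norm_power)
    have fin: "L (avg n) \<le> R" if n: "2 * K < int n" "0 < n" for n
    proof -
      let ?A = "{..<n} \<times> {..<n}"
      define E where "E q x = torus_char n (fst q) (snd q) x" for q x
      define U where "U s x = (\<Sum>q\<in>B. uB s q * E q x)" for s x
      define W where "W m x = (\<Sum>s\<in>UNIV. f (Z n x) (V n x) m s * U s x)" for m x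
      have orth: "(\<Sum>x\<in>?A. E p x * cnj (E q x)) = (if p = q then complex_of_real ((real n)\<^sup>2) else 0)"
        if "p \<in> B" "q \<in> B" for p q
        unfolding E_def using torus_char_orthogonal n(1) that by (simp add: B_def)
      \<comment> \<open>The Fourier coefficients of the product are a convolution.\<close>
      have coeff: "(\<Sum>x\<in>?A. W m x * cnj (E p x))
         = (of_nat n)\<^sup>2 * (\<Sum>s\<in>UNIV. \<Sum>q\<in>B. avg n (fst q - fst p) (snd q - snd p) m s * uB s q)" for m p
      proof -
        have EE: "E q x * cnj (E p x) = torus_char n (fst q - fst p) (snd q - snd p) x" for q x
          by (simp add: E_def torus_char_cnj torus_char_mult)
        have "(\<Sum>x\<in>?A. W m x * cnj (E p x))
            = (\<Sum>x\<in>?A. \<Sum>s\<in>UNIV. \<Sum>q\<in>B. f (Z n x) (V n x) m s * (E q x * cnj (E p x)) * uB s q)"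
          unfolding W_def U_def by (simp add: sum_distrib_left sum_distrib_right mult_ac)
        also have "\<dots> = (\<Sum>s\<in>UNIV. \<Sum>x\<in>?A. \<Sum>q\<in>B. f (Z n x) (V n x) m s * (E q x * cnj (E p x)) * uB s q)"
          by (rule sum.swap)
        also have "\<dots> = (\<Sum>s\<in>UNIV. \<Sum>q\<in>B. \<Sum>x\<in>?A. f (Z n x) (V n x) m s * (E q x * cnj (E p x)) * uB s q)"
          by (intro sum.cong refl sum.swap)
        also have "\<dots> = (\<Sum>s\<in>UNIV. \<Sum>q\<in>B. (of_nat n)\<^sup>2 * (avg n (fst q - fst p) (snd q - snd p) m s * uB s q))"
          unfolding EE avg_def using n(2) by (simp add: sum_distrib_right[symmetric])
        finally show ?thesis by (simp only: sum_distrib_left[symmetric])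
      qed
      have "(real n)\<^sup>2 * ((real n)\<^sup>2 * L (avg n)) = (\<Sum>m\<in>UNIV. \<Sum>p\<in>B. (cmod (\<Sum>x\<in>?A. W m x * cnj (E p x)))\<^sup>2)"
        unfolding coeff L_def
        by (simp only: norm_mult norm_power norm_of_nat power_mult_distrib sum_distrib_left[symmetric])
           (simp add: power2_eq_square mult.assoc)
      also have "\<dots> \<le> (\<Sum>m\<in>UNIV. (real n)\<^sup>2 * (\<Sum>x\<in>?A. (cmod (W m x))\<^sup>2))"
        using n(2) by (intro sum_mono orthogonal_bessel[OF B _ orth]) auto
      also have "\<dots> = (real n)\<^sup>2 * (\<Sum>x\<in>?A. \<Sum>m\<in>UNIV. (cmod (W m x))\<^sup>2)"
        by (subst sum.swap) (simp only: sum_distrib_left)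
      also have "\<dots> \<le> (real n)\<^sup>2 * (\<Sum>x\<in>?A. \<Sum>s\<in>UNIV. (cmod (U s x))\<^sup>2)"
        unfolding W_def by (intro mult_left_mono sum_mono contr ZV) auto
      also have "(\<Sum>x\<in>?A. \<Sum>s\<in>UNIV. (cmod (U s x))\<^sup>2) = (\<Sum>s\<in>UNIV. \<Sum>x\<in>?A. (cmod (U s x))\<^sup>2)"
        by (rule sum.swap)
      also have "\<dots> = (\<Sum>s\<in>UNIV. (real n)\<^sup>2 * (\<Sum>q\<in>B. (cmod (uB s q))\<^sup>2))"
        unfolding U_def by (intro sum.cong refl orthogonal_parseval[OF B orth])
      also have "\<dots> = (real n)\<^sup>2 * R" by (simp only: R_def sum_distrib_left)
      finally show ?thesis using n(2) by simp
    qed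
    have "(\<lambda>n. avg n d e m s) \<longlonglongrightarrow> C d e m s * of_real (\<rho>\<^sup>2) ^ (nat d + nat e)" for d e m s
      using discrete_fourier_tendsto[OF sums bound \<rho>, of m s d e]
      by (simp add: avg_def Z_def V_def C_def if_distrib if_distribR cong: if_cong)
    then have "(\<lambda>n. L (avg n)) \<longlonglongrightarrow> L (\<lambda>d e m s. C d e m s * of_real (\<rho>\<^sup>2) ^ (nat d + nat e))"
      unfolding L_def by (intro tendsto_intros)
    moreover have "eventually (\<lambda>n. L (avg n) \<le> R) sequentially"
      using eventually_gt_at_top[of "nat (2 * K)"] by eventually_elim (auto intro: fin)
    ultimately show ?thesis by (rule tendsto_upperbound) auto
  qed
  then have "eventually (\<lambda>\<rho>. L (\<lambda>d e m s. C d e m s * of_real (\<rho>\<^sup>2) ^ (nat d + nat e)) \<le> R) (at_left (1::real))"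
    using eventually_at_left_real[of 0 1] by (auto elim!: eventually_mono)
  moreover have "((\<lambda>\<rho>. L (\<lambda>d e m s. C d e m s * of_real (\<rho>\<^sup>2) ^ (nat d + nat e))) \<longlongrightarrow>
      L (\<lambda>d e m s. C d e m s * of_real (1\<^sup>2) ^ (nat d + nat e))) (at_left (1::real))"
    unfolding L_def by (intro tendsto_intros)
  ultimately have LR: "L C \<le> R"
    using tendsto_upperbound[of _ _ "at_left (1::real)" R] by simp
  have toep: "toeplitz C u (fst p, snd p, m) = (\<Sum>s\<in>UNIV. \<Sum>q\<in>B. C (fst q - fst p) (snd q - snd p) m s * uB s q)" for p m
  proof -
    have "toeplitz C u (fst p, snd p, m) = (\<Sum>(k, l, s)\<in>(\<lambda>(s, q). (fst q, snd q, s)) ` (UNIV \<times> B).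
        C (k - fst p) (l - snd p) m s * u (k, l, s))"
      using B uK by (intro toeplitz_eq_sum) (force simp: image_iff)+
    also have "\<dots> = (\<Sum>(s, q)\<in>UNIV \<times> B. C (fst q - fst p) (snd q - snd p) m s * uB s q)"
      by (subst sum.reindex) (auto simp: inj_on_def uB_def intro!: sum.cong)
    finally show ?thesis by (simp add: sum.cartesian_product)
  qed
  have "sqnorm u = (\<Sum>p\<in>(\<lambda>(s, q). (fst q, snd q, s)) ` (UNIV \<times> B). (cmod (u p))\<^sup>2)"
    using B uK by (intro sqnorm_eq_sum) (force simp: image_iff)+
  also have "\<dots> = (\<Sum>(s, q)\<in>UNIV \<times> B. (cmod (uB s q))\<^sup>2)"
    by (subst sum.reindex) (auto simp: inj_on_def uB_def intro!: sum.cong)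
  finally have su: "sqnorm u = R" by (simp add: R_def sum.cartesian_product)
  have "(\<Sum>y\<in>F. (cmod (toeplitz C u y))\<^sup>2) \<le> (\<Sum>y\<in>(\<lambda>(m, p). (fst p, snd p, m)) ` (UNIV \<times> B). (cmod (toeplitz C u y))\<^sup>2)"
    using B FK by (intro sum_mono2) (force simp: image_iff)+
  also have "\<dots> = (\<Sum>(m, p)\<in>UNIV \<times> B. (cmod (toeplitz C u (fst p, snd p, m)))\<^sup>2)"
    by (subst sum.reindex) (auto simp: inj_on_def intro!: sum.cong)
  also have "\<dots> = L C" by (simp add: L_def toep sum.cartesian_product)
  finally show ?thesis using LR su unfolding C_def [abs_def] by simp
qed

section \<open>Kernels given by power series\<close>

definition monom2 :: "complex ^ 2 \<Rightarrow> nat \<times> nat \<Rightarrow> complex" where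
  "monom2 z = (\<lambda>(k, l). (z $ 1) ^ k * (z $ 2) ^ l)"

definition power_kernel ::
  "(int \<times> int \<times> 'n \<Rightarrow> int \<times> int \<times> 'n \<Rightarrow> complex) \<Rightarrow> complex ^ 2 \<Rightarrow> complex ^ 2 \<Rightarrow> complex ^ 'n ^ 'n" where
  "power_kernel \<kappa> w z = (\<chi> s t. \<Sum>\<^sub>\<infinity>((i, j), (k, l))\<in>UNIV \<times> UNIV.
     \<kappa> (int i, int j, s) (int k, int l, t) * (cnj (monom2 w (i, j)) * monom2 z (k, l)))"

lemma in_bidisk: "z \<in> bidisk \<longleftrightarrow> cmod (z $ 1) < 1 \<and> cmod (z $ 2) < 1"
  by (simp add: bidisk_def forall_2)

lemma monom2_norm_summable:
  assumes "z \<in> bidisk" shows "(\<lambda>\<alpha>. cmod (monom2 z \<alpha>)) summable_on UNIV"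
  using has_sum_imp_summable[OF has_sum_geometric2[of "cmod (z $ 1)" "cmod (z $ 2)"]] assms
  by (simp add: monom2_def in_bidisk norm_mult norm_power case_prod_unfold)

lemma monom2_product_summable:
  assumes "w \<in> bidisk" "z \<in> bidisk"
  shows "(\<lambda>(\<alpha>, \<beta>). cmod (cnj (monom2 w \<alpha>) * monom2 z \<beta>)) summable_on UNIV \<times> UNIV"
proof (rule has_sum_product(2)[OF has_sum_infsum has_sum_infsum])
  show w: "(\<lambda>\<alpha>. cmod (cnj (monom2 w \<alpha>))) summable_on UNIV" and z: "(\<lambda>\<alpha>. cmod (monom2 z \<alpha>)) summable_on UNIV"
    using monom2_norm_summable assms by auto
  show "(\<lambda>\<alpha>. cnj (monom2 w \<alpha>)) summable_on UNIV" by (rule abs_summable_summable[OF w])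
  show "monom2 z summable_on UNIV" by (rule abs_summable_summable[OF z])
qed

lemma power_kernel_has_sum:
  assumes bound: "\<And>p q. cmod (\<kappa> p q) \<le> M" and "w \<in> bidisk" "z \<in> bidisk"
  shows "((\<lambda>((i, j), (k, l)). \<kappa> (int i, int j, s) (int k, int l, t) * (cnj (monom2 w (i, j)) * monom2 z (k, l)))
    has_sum power_kernel \<kappa> w z $ s $ t) (UNIV \<times> UNIV)"
proof -
  let ?F = "\<lambda>((i, j), (k, l)). \<kappa> (int i, int j, s) (int k, int l, t) * (cnj (monom2 w (i, j)) * monom2 z (k, l))"
  have "?F summable_on UNIV \<times> UNIV"
  proof (rule summable_on_dominated)
    show "(\<lambda>x. M * (\<lambda>(\<alpha>, \<beta>). cmod (cnj (monom2 w \<alpha>) * monom2 z \<beta>)) x) summable_on UNIV \<times> UNIV"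
      by (intro summable_on_cmult_right monom2_product_summable assms)
    show "cmod (?F x) \<le> M * (\<lambda>(\<alpha>, \<beta>). cmod (cnj (monom2 w \<alpha>) * monom2 z \<beta>)) x" for x
      by (cases x) (auto simp: norm_mult intro!: mult_right_mono bound)
  qed
  then show ?thesis by (simp add: power_kernel_def has_sum_infsum)
qed

text \<open>
Positivity of a form is available on finitely supported sequences, so the kernels are
approximated by their truncations to index boxes.
\<close>

lemma filterlim_box2:
  "filterlim (\<lambda>N. ({..<N} \<times> {..<N}) \<times> ({..<N} \<times> {..<N})) (finite_subsets_at_top ((UNIV \<times> UNIV) :: ((nat \<times> nat) \<times> (nat \<times> nat)) set)) sequentially"
  unfolding filterlim_finite_subsets_at_top
proof safe
  fix X :: "((nat \<times> nat) \<times> (nat \<times> nat)) set" assume X: "finite X"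
  define M where "M = (\<Sum>((i, j), (k, l))\<in>X. i + j + k + l)"
  have M: "i \<le> M \<and> j \<le> M \<and> k \<le> M \<and> l \<le> M" if "((i, j), (k, l)) \<in> X" for i j k l
  proof -
    have "i + j + k + l \<le> M"
      using member_le_sum[OF that, of "\<lambda>((i, j), (k, l)). i + j + k + l"] X by (simp add: M_def case_prod_unfold)
    then show ?thesis by simp
  qed
  show "\<forall>\<^sub>F N in sequentially. finite (({..<N} \<times> {..<N}) \<times> ({..<N} \<times> {..<N})) \<and> X \<subseteq> ({..<N} \<times> {..<N}) \<times> ({..<N} \<times> {..<N})
     \<and> ({..<N} \<times> {..<N}) \<times> ({..<N} \<times> {..<N}) \<subseteq> UNIV \<times> UNIV"
    using eventually_gt_at_top[of M] by eventually_elim (use M in \<open>fastforce dest: M\<close>)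
qed

lemma sum_bilinear:
  fixes k :: "'s \<Rightarrow> 't \<Rightarrow> 'a::comm_semiring_0"
  shows "(\<Sum>s\<in>S. \<Sum>t\<in>T. k s t * (\<Sum>d\<in>D. A d t) * (\<Sum>b\<in>E. B b s))
    = (\<Sum>b\<in>E. \<Sum>d\<in>D. \<Sum>s\<in>S. \<Sum>t\<in>T. k s t * A d t * B b s)"
proof -
  have "(\<Sum>s\<in>S. \<Sum>t\<in>T. k s t * (\<Sum>d\<in>D. A d t) * (\<Sum>b\<in>E. B b s))
      = (\<Sum>s\<in>S. \<Sum>t\<in>T. \<Sum>b\<in>E. k s t * (\<Sum>d\<in>D. A d t) * B b s)"
    by (simp only: sum_distrib_left)
  also have "\<dots> = (\<Sum>s\<in>S. \<Sum>b\<in>E. \<Sum>t\<in>T. k s t * (\<Sum>d\<in>D. A d t) * B b s)"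
    by (intro sum.cong refl sum.swap)
  also have "\<dots> = (\<Sum>b\<in>E. \<Sum>s\<in>S. \<Sum>t\<in>T. k s t * (\<Sum>d\<in>D. A d t) * B b s)"
    by (rule sum.swap)
  also have "\<dots> = (\<Sum>b\<in>E. \<Sum>s\<in>S. \<Sum>t\<in>T. \<Sum>d\<in>D. k s t * A d t * B b s)"
    by (simp only: sum_distrib_left sum_distrib_right)
  also have "\<dots> = (\<Sum>b\<in>E. \<Sum>s\<in>S. \<Sum>d\<in>D. \<Sum>t\<in>T. k s t * A d t * B b s)"
    by (intro sum.cong refl sum.swap)
  also have "\<dots> = (\<Sum>b\<in>E. \<Sum>d\<in>D. \<Sum>s\<in>S. \<Sum>t\<in>T. k s t * A d t * B b s)"
    by (intro sum.cong refl sum.swap)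
  finally show ?thesis .
qed

text \<open>
The truncated Gram sum of the kernel at points \<open>x b\<close> and vectors \<open>v b\<close> is the value of the form at
the truncation of \<open>\<Sum>b. (x b)\<^sup>\<alpha> * v b\<close>, hence nonnegative.
\<close>

lemma psd_power_kernel:
  fixes a :: "(int \<times> int \<times> 'n::finite \<Rightarrow> complex) \<Rightarrow> real"
  assumes quad: "quadratic_form a" and nonneg: "\<And>u. finsupp u \<Longrightarrow> 0 \<le> a u"
    and bound: "\<And>p q. cmod (form_coeff a p q) \<le> M"
  shows "psd_kernel_on bidisk (power_kernel (form_coeff a))"
  unfolding psd_kernel_on_def
proof (intro allI impI)
  fix n and x :: "nat \<Rightarrow> complex ^ 2" and v :: "nat \<Rightarrow> complex ^ 'n"
  assume x: "\<forall>i<n. x i \<in> bidisk"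
  let ?\<kappa> = "form_coeff a"
  define \<Phi> where "\<Phi> = (\<lambda>((i, j), (k, l)). \<Sum>b<n. \<Sum>d<n. \<Sum>s\<in>UNIV. \<Sum>t\<in>UNIV.
    ?\<kappa> (int i, int j, s) (int k, int l, t) * (cnj (monom2 (x b) (i, j)) * monom2 (x d) (k, l)) * (v d $ t * cnj (v b $ s)))"
  define S where "S = (\<Sum>b<n. \<Sum>d<n. \<Sum>s\<in>UNIV. \<Sum>t\<in>UNIV. power_kernel ?\<kappa> (x b) (x d) $ s $ t * (v d $ t * cnj (v b $ s)))"
  have "(\<Phi> has_sum S) (UNIV \<times> UNIV)"
    unfolding \<Phi>_def S_def case_prod_unfold
    using x power_kernel_has_sum[of ?\<kappa> M, OF bound, unfolded case_prod_unfold]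
    by (intro has_sum_finite_sum has_sum_cmult_left) auto
  then have "(sum \<Phi> \<longlongrightarrow> S) (finite_subsets_at_top (UNIV \<times> UNIV))" by (simp add: has_sum_def)
  from filterlim_compose[OF this filterlim_box2]
  have lim: "(\<lambda>N. sum \<Phi> (({..<N} \<times> {..<N}) \<times> ({..<N} \<times> {..<N}))) \<longlonglongrightarrow> S" .
  have "sum \<Phi> (({..<N} \<times> {..<N}) \<times> ({..<N} \<times> {..<N})) \<in> \<real>\<^sub>\<ge>\<^sub>0" for N
  proof -
    let ?I = "{..<N} \<times> {..<N}"
    define h :: "(nat \<times> nat) \<times> 'n \<Rightarrow> int \<times> int \<times> 'n" where "h = (\<lambda>((i, j), s). (int i, int j, s))"
    define U where "U = (\<lambda>(\<alpha>, s). \<Sum>b<n. monom2 (x b) \<alpha> * v b $ s)"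
    have h: "inj h" by (auto simp: inj_on_def h_def)
    define u where "u p = (if p \<in> h ` (?I \<times> UNIV) then U (inv h p) else 0)" for p
    have uh: "u (h y) = U y" if "y \<in> ?I \<times> UNIV" for y using that h by (simp add: u_def)
    have "complex_of_real (a u) = (\<Sum>p\<in>h ` (?I \<times> UNIV). \<Sum>q\<in>h ` (?I \<times> UNIV). ?\<kappa> p q * u q * cnj (u p))"
      unfolding form_coeff_def by (rule quadratic_form_eq_sum[OF quad nonneg]) (auto simp: u_def)
    also have "\<dots> = (\<Sum>y\<in>?I \<times> UNIV. \<Sum>y'\<in>?I \<times> UNIV. ?\<kappa> (h y) (h y') * U y' * cnj (U y))"
      using h uh by (simp add: sum.reindex inj_on_subset[OF h])
    also have "\<dots> = (\<Sum>\<alpha>\<in>?I. \<Sum>s\<in>UNIV. \<Sum>\<beta>\<in>?I. \<Sum>t\<in>UNIV. ?\<kappa> (h (\<alpha>, s)) (h (\<beta>, t)) * U (\<beta>, t) * cnj (U (\<alpha>, s)))"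
      by (simp only: sum.cartesian_product')
    also have "\<dots> = (\<Sum>\<alpha>\<in>?I. \<Sum>\<beta>\<in>?I. \<Sum>s\<in>UNIV. \<Sum>t\<in>UNIV. ?\<kappa> (h (\<alpha>, s)) (h (\<beta>, t)) * U (\<beta>, t) * cnj (U (\<alpha>, s)))"
      by (intro sum.cong refl sum.swap)
    also have "\<dots> = (\<Sum>\<alpha>\<in>?I. \<Sum>\<beta>\<in>?I. \<Phi> (\<alpha>, \<beta>))"
    proof (intro sum.cong refl)
      fix \<alpha> \<beta> :: "nat \<times> nat"
      have "(\<Sum>s\<in>UNIV. \<Sum>t\<in>UNIV. ?\<kappa> (h (\<alpha>, s)) (h (\<beta>, t)) * U (\<beta>, t) * cnj (U (\<alpha>, s)))
        = (\<Sum>b<n. \<Sum>d<n. \<Sum>s\<in>UNIV. \<Sum>t\<in>UNIV. ?\<kappa> (h (\<alpha>, s)) (h (\<beta>, t)) *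
            (monom2 (x d) \<beta> * v d $ t) * cnj (monom2 (x b) \<alpha> * v b $ s))"
        unfolding U_def split cnj_sum by (rule sum_bilinear)
      then show "(\<Sum>s\<in>UNIV. \<Sum>t\<in>UNIV. ?\<kappa> (h (\<alpha>, s)) (h (\<beta>, t)) * U (\<beta>, t) * cnj (U (\<alpha>, s))) = \<Phi> (\<alpha>, \<beta>)"
        by (simp add: \<Phi>_def h_def case_prod_unfold mult_ac)
    qed
    also have "\<dots> = sum \<Phi> (?I \<times> ?I)" by (simp only: sum.cartesian_product')
    finally have "sum \<Phi> (?I \<times> ?I) = complex_of_real (a u)" by simp
    moreover have "finsupp u" by (rule finsupp_superset[of "h ` (?I \<times> UNIV)"]) (auto simp: u_def)
    ultimately show ?thesis using nonneg by simp
  qed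
  then have "S \<in> \<real>\<^sub>\<ge>\<^sub>0"
    by (intro closed_sequentially[OF closed_nonneg_Reals_complex _ lim]) auto
  also have "S = (\<Sum>i<n. \<Sum>j<n. cinner_vec (power_kernel ?\<kappa> (x i) (x j) *v v j) (v i))"
    unfolding S_def cinner_vec_def matrix_vector_mult_def
    by (simp add: sum_distrib_left sum_distrib_right mult.assoc)
  finally show "(\<Sum>i<n. \<Sum>j<n. cinner_vec (power_kernel ?\<kappa> (x i) (x j) *v v j) (v i)) \<in> \<real>\<^sub>\<ge>\<^sub>0" .
qed

text \<open>
Multiplying the kernel by a monomial shifts both indices of the coefficients. After reindexing, the
sum over the shifted quadrants extends to all indices because the coefficients vanish as soon as one of the two
indices leaves the quadrant.
\<close>

lemma power_kernel_shift_has_sum: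
  assumes bound: "\<And>p q. cmod (\<kappa> p q) \<le> M" and wz: "w \<in> bidisk" "z \<in> bidisk"
    and vanish: "\<And>i j r p. i < 0 \<or> j < 0 \<Longrightarrow> \<kappa> p (i, j, r) = 0 \<and> \<kappa> (i, j, r) p = 0"
  shows "((\<lambda>((i, j), (k, l)). \<kappa> (int i - int d, int j - int e, s) (int k - int d, int l - int e, t) *
      (cnj (monom2 w (i, j)) * monom2 z (k, l)))
    has_sum cnj (monom2 w (d, e)) * monom2 z (d, e) * power_kernel \<kappa> w z $ s $ t) (UNIV \<times> UNIV)"
    (is "(?G has_sum ?A) _")
proof -
  define h :: "(nat \<times> nat) \<times> (nat \<times> nat) \<Rightarrow> (nat \<times> nat) \<times> (nat \<times> nat)"
    where "h = (\<lambda>((i, j), (k, l)). ((i + d, j + e), (k + d, l + e)))"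
  have h: "inj h" by (auto simp: inj_on_def h_def)
  have "(?G \<circ> h has_sum ?A) (UNIV \<times> UNIV)"
    using has_sum_cmult_right[OF power_kernel_has_sum[of \<kappa> M w z s t, OF bound wz],
        of "cnj (monom2 w (d, e)) * monom2 z (d, e)"]
    by (rule has_sum_cong[THEN iffD1, rotated]) (auto simp: h_def monom2_def power_add mult_ac)
  then have "(?G has_sum ?A) (range h)" by (simp add: has_sum_reindex[OF h])
  also have "?this \<longleftrightarrow> (?G has_sum ?A) (UNIV \<times> UNIV)"
  proof (rule has_sum_cong_neutral)
    fix x assume "x \<in> UNIV \<times> UNIV - range h"
    obtain i j k l where x: "x = ((i, j), (k, l))" by (metis surj_pair)
    have "i < d \<or> j < e \<or> k < d \<or> l < e"
    proof (rule ccontr)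
      assume "\<not> (i < d \<or> j < e \<or> k < d \<or> l < e)"
      then have "x = h ((i - d, j - e), (k - d, l - e))" by (simp add: x h_def)
      with \<open>x \<in> UNIV \<times> UNIV - range h\<close> show False by blast
    qed
    then show "?G x = 0" using vanish by (auto simp: x)
  qed auto
  finally show ?thesis .
qed

section \<open>The decomposition for functions in the unit ball\<close>

text \<open>
A complex affine disk in the bidisk, in particular a slice parallel to an axis, turns the complex
linear Frechet derivative into a complex derivative.
\<close>

lemma holomorphic_mat_on_slice:
  fixes f :: "complex ^ 2 \<Rightarrow> complex ^ 'n ^ 'm" and L :: "complex \<Rightarrow> complex ^ 2"
  assumes "holomorphic_mat_on f bidisk" and embed: "\<And>t. L t = e t + b" "bounded_linear e" "\<And>c t. e (c * t) = c *s e t"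
    and into: "\<And>t. t \<in> ball 0 1 \<Longrightarrow> L t \<in> bidisk"
  shows "(\<lambda>t. f (L t) $ m $ s) holomorphic_on ball 0 1"
proof (rule holomorphic_onI)
  fix t :: complex assume t: "t \<in> ball 0 1"
  then obtain D where D: "(f has_derivative D) (at (L t) within bidisk)" "\<And>c h. D (c *s h) = cscale_mat c (D h)"
    using assms(1) into unfolding holomorphic_mat_on_def by blast
  have L: "(L has_derivative e) (at t within ball 0 1)"
    unfolding embed(1) [abs_def] by (intro has_derivative_add_const bounded_linear_imp_has_derivative embed(2))
  have "L ` ball 0 1 \<subseteq> bidisk" using into by blast
  then have "((\<lambda>t. f (L t)) has_derivative (\<lambda>h. D (e h))) (at t within ball 0 1)"
    using has_derivative_in_compose[OF L has_derivative_subset[OF D(1) \<open>L ` ball 0 1 \<subseteq> bidisk\<close>]] by simp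
  then have "((\<lambda>t. f (L t) $ m $ s) has_derivative (\<lambda>h. D (e h) $ m $ s)) (at t within ball 0 1)"
    by (intro bounded_linear.has_derivative[OF bounded_linear_vec_nth])
  moreover have "D (e h) $ m $ s = (D (e 1) $ m $ s) * h" for h
    using embed(3)[of h 1] D(2)[of h "e 1"] by (simp add: cscale_mat_def map_matrix_def)
  then have "(\<lambda>h. D (e h) $ m $ s) = (*) (D (e 1) $ m $ s)" by (rule ext)
  ultimately have "((\<lambda>t. f (L t) $ m $ s) has_field_derivative (D (e 1) $ m $ s)) (at t within ball 0 1)"
    by (simp only: has_field_derivative_def)
  then show "(\<lambda>t. f (L t) $ m $ s) field_differentiable at t within ball 0 1"
    unfolding field_differentiable_def by blast
qed

lemma norm_vec_power2: "(norm (x :: complex ^ 'n))\<^sup>2 = (\<Sum>i\<in>UNIV. (norm (x $ i))\<^sup>2)"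
  by (simp add: norm_vec_def L2_set_def sum_nonneg)

theorem corollary6p5:
  fixes f :: "complex ^ 2 \<Rightarrow> complex ^ 'n ^ 'm"
  assumes "holomorphic_mat_on f bidisk"
    and "\<forall>z\<in>bidisk. onorm ((*v) (f z)) \<le> 1"
  shows "\<exists>k1 k2 :: complex ^ 2 \<Rightarrow> complex ^ 2 \<Rightarrow> complex ^ 'n ^ 'n.
    psd_kernel_on bidisk k1 \<and> psd_kernel_on bidisk k2 \<and>
    (\<forall>w\<in>bidisk. \<forall>z\<in>bidisk.
       mat 1 - conj_transpose (f w) ** f z =
         cscale_mat (1 - cnj (w $ 1) * z $ 1) (k1 w z) +
         cscale_mat (1 - cnj (w $ 2) * z $ 2) (k2 w z))"
proof -
  define F :: "complex \<Rightarrow> complex \<Rightarrow> 'm \<Rightarrow> 'n \<Rightarrow> complex" where "F z w m s = f (vector [z, w]) $ m $ s" for z w m s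
  have vec: "vector [z, w] \<in> bidisk" if "z \<in> ball 0 1" "w \<in> ball 0 1" for z w :: complex
    using that by (simp add: in_bidisk)
  have contr: "(\<Sum>m\<in>UNIV. (cmod (\<Sum>s\<in>UNIV. F z w m s * x s))\<^sup>2) \<le> (\<Sum>s\<in>UNIV. (cmod (x s))\<^sup>2)"
    if zw: "z \<in> ball 0 1" "w \<in> ball 0 1" for z w x
  proof -
    let ?A = "f (vector [z, w])" and ?x = "\<chi> s. x s"
    have "norm (?A *v ?x) \<le> onorm ((*v) ?A) * norm ?x"
      by (rule onorm[OF matrix_vector_mul_bounded_linear])
    also have "\<dots> \<le> 1 * norm ?x"
      using assms(2) vec[OF zw] by (intro mult_right_mono) auto
    finally have "(norm (?A *v ?x))\<^sup>2 \<le> (norm ?x)\<^sup>2" by (simp add: power_mono)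
    then show ?thesis by (simp add: norm_vec_power2 matrix_vector_mult_def F_def)
  qed
  have entry: "cmod (F z w m s) \<le> 1" if zw: "z \<in> ball 0 1" "w \<in> ball 0 1" for z w m s
  proof -
    have "(cmod (F z w m s))\<^sup>2 \<le> (\<Sum>m\<in>UNIV. (cmod (F z w m s))\<^sup>2)" by (rule member_le_sum) auto
    also have "\<dots> \<le> (\<Sum>t\<in>UNIV. (cmod (if t = s then 1 else 0))\<^sup>2)"
      using contr[OF zw, of "\<lambda>t. if t = s then 1 else 0"] by (simp add: if_distrib[of "\<lambda>x. F z w _ _ * x"] cong: if_cong)
    also have "\<dots> = (\<Sum>t\<in>UNIV. if t = s then 1 else 0)" by (intro sum.cong) auto
    also have "\<dots> = 1" by simp
    finally show ?thesis by (simp add: abs_square_le_1)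
  qed
  have holo1: "(\<lambda>z. F z w m s) holomorphic_on ball 0 1" if w: "w \<in> ball 0 1" for w m s
    unfolding F_def
  proof (rule holomorphic_mat_on_slice[OF assms(1), where e = "\<lambda>z. vector [z, 0]" and b = "vector [0, w]"])
    show "bounded_linear (\<lambda>z. vector [z, 0] :: complex ^ 2)"
      by (simp add: linear_conv_bounded_linear[symmetric] linear_iff vec_eq_iff forall_2)
  qed (use vec w in \<open>auto simp: vec_eq_iff forall_2\<close>)
  have holo2: "(\<lambda>w. F z w m s) holomorphic_on ball 0 1" if z: "z \<in> ball 0 1" for z m s
    unfolding F_def
  proof (rule holomorphic_mat_on_slice[OF assms(1), where e = "\<lambda>w. vector [0, w]" and b = "vector [z, 0]"])
    show "bounded_linear (\<lambda>w. vector [0, w] :: complex ^ 2)"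
      by (simp add: linear_conv_bounded_linear[symmetric] linear_iff vec_eq_iff forall_2)
  qed (use vec z in \<open>auto simp: vec_eq_iff forall_2\<close>)
  \<comment> \<open>A name for the property keeps the simultaneous choice of Taylor coefficients for all entries first-order.\<close>
  define taylor where "taylor m s c \<longleftrightarrow> (\<forall>k l. cmod (c k l) \<le> 1) \<and>
     (\<forall>z\<in>ball 0 1. \<forall>w\<in>ball 0 1. ((\<lambda>(k, l). c k l * z ^ k * w ^ l) has_sum F z w m s) UNIV)"
    for m :: 'm and s :: 'n and c :: "nat \<Rightarrow> nat \<Rightarrow> complex"
  have "\<exists>c. taylor m s c" for m s
    unfolding taylor_def by (intro taylor_unit_bidisk holo1 holo2 entry)
  then obtain c where c: "taylor m s (c m s)" for m s by metis
  have bound: "\<And>k l m s. cmod (c m s k l) \<le> 1"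
    and sums: "\<And>z w m s. z \<in> ball 0 1 \<Longrightarrow> w \<in> ball 0 1 \<Longrightarrow>
      ((\<lambda>(k, l). c m s k l * z ^ k * w ^ l) has_sum F z w m s) UNIV"
    using c unfolding taylor_def by blast+
  define C where "C i j m s = (if 0 \<le> i \<and> 0 \<le> j then c m s (nat i) (nat j) else 0)" for i j m s
  interpret contractive_symbol C
  proof
    show "C i j m s = 0" if "i < 0 \<or> j < 0" for i j m s using that by (auto simp: C_def)
    show "(\<Sum>y\<in>A. (cmod (toeplitz C u y))\<^sup>2) \<le> sqnorm u" if "finsupp u" "finite A" for u A
      unfolding C_def [abs_def] using sums bound contr that by (rule toeplitz_contractive)
  qed
  define \<kappa>1 where "\<kappa>1 = form_coeff form1"
  define \<kappa>2 where "\<kappa>2 = form_coeff form2"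
  have b1: "cmod (\<kappa>1 p q) \<le> 4" for p q
    unfolding \<kappa>1_def by (intro form_coeff_bounded form1_nonneg form1_le quadratic_form_form1)
  have b2: "cmod (\<kappa>2 p q) \<le> 4" for p q
    unfolding \<kappa>2_def by (intro form_coeff_bounded form2_nonneg form2_le quadratic_form_form2)
  have v1: "\<kappa>1 p (i, j, r) = 0 \<and> \<kappa>1 (i, j, r) p = 0" if "i < 0 \<or> j < 0" for i j r p
    using form_coeff_vanish[OF quadratic_form_form1 quadrant_local_form1 that] by (simp add: \<kappa>1_def)
  have v2: "\<kappa>2 p (i, j, r) = 0 \<and> \<kappa>2 (i, j, r) p = 0" if "i < 0 \<or> j < 0" for i j r p
    using form_coeff_vanish[OF quadratic_form_form2 quadrant_local_form2 that] by (simp add: \<kappa>2_def)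
  let ?k1 = "power_kernel \<kappa>1" and ?k2 = "power_kernel \<kappa>2"
  have psd: "psd_kernel_on bidisk ?k1" "psd_kernel_on bidisk ?k2"
    unfolding \<kappa>1_def \<kappa>2_def
    by (rule psd_power_kernel[where M = 4]; use quadratic_form_form1 quadratic_form_form2 form1_nonneg form2_nonneg b1 b2
          in \<open>simp add: \<kappa>1_def \<kappa>2_def\<close>)+
  have "mat 1 - conj_transpose (f w) ** f z =
         cscale_mat (1 - cnj (w $ 1) * z $ 1) (?k1 w z) + cscale_mat (1 - cnj (w $ 2) * z $ 2) (?k2 w z)"
    if wz: "w \<in> bidisk" "z \<in> bidisk" for w z
  proof -
    have f_sum: "((\<lambda>(k, l). c m s k l * monom2 z (k, l)) has_sum f z $ m $ s) UNIV" if "z \<in> bidisk" for z m s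
    proof -
      have "vector [z $ 1, z $ 2] = z" by (simp add: vec_eq_iff forall_2)
      then show ?thesis
        using sums[of "z $ 1" "z $ 2" m s] that by (simp add: in_bidisk F_def monom2_def mult.assoc)
    qed
    have f_norm: "(\<lambda>x. cmod (case x of (k, l) \<Rightarrow> c m s k l * monom2 z (k, l))) summable_on UNIV" if "z \<in> bidisk" for z m s
      by (rule summable_on_comparison_test[OF monom2_norm_summable[OF that]])
         (auto simp: norm_mult intro!: mult_left_le_one_le bound)
    have entry_eq: "(if s = t then 1 else 0) - (\<Sum>m\<in>UNIV. cnj (f w $ m $ s) * f z $ m $ t)
       = (1 - cnj (w $ 1) * z $ 1) * ?k1 w z $ s $ t + (1 - cnj (w $ 2) * z $ 2) * ?k2 w z $ s $ t" for s t
    proof -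
      let ?mon = "\<lambda>i j k l. cnj (monom2 w (i, j)) * monom2 z (k, l)"
      \<comment> \<open>In every entry, both sides are sums of absolutely convergent power series, so the coefficients can be compared.\<close>
      define A1 where "A1 = (\<lambda>((i, j), (k, l)). \<kappa>1 (int i, int j, s) (int k, int l, t) * ?mon i j k l)"
      define A2 where "A2 = (\<lambda>((i, j), (k, l)). \<kappa>2 (int i, int j, s) (int k, int l, t) * ?mon i j k l)"
      define B1 where "B1 = (\<lambda>((i, j), (k, l)). \<kappa>1 (int i - 1, int j, s) (int k - 1, int l, t) * ?mon i j k l)"
      define B2 where "B2 = (\<lambda>((i, j), (k, l)). \<kappa>2 (int i, int j - 1, s) (int k, int l - 1, t) * ?mon i j k l)"
      define D where "D = (\<lambda>((i, j), (k, l)).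
        (if i = 0 \<and> j = 0 \<and> k = 0 \<and> l = 0 \<and> s = t then 1 else 0) * ?mon i j k l)"
      define P where "P = (\<lambda>((i, j), (k, l)).
        (\<Sum>m\<in>UNIV. C (int k) (int l) m t * cnj (C (int i) (int j) m s)) * ?mon i j k l)"
      have A: "(A1 has_sum ?k1 w z $ s $ t) (UNIV \<times> UNIV)" "(A2 has_sum ?k2 w z $ s $ t) (UNIV \<times> UNIV)"
        unfolding A1_def A2_def by (rule power_kernel_has_sum[OF b1 wz], rule power_kernel_has_sum[OF b2 wz])
      have mon: "monom2 z (1, 0) = z $ 1" "monom2 z (0, 1) = z $ 2" for z by (simp_all add: monom2_def)
      have B: "(B1 has_sum cnj (w $ 1) * z $ 1 * ?k1 w z $ s $ t) (UNIV \<times> UNIV)"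
        "(B2 has_sum cnj (w $ 2) * z $ 2 * ?k2 w z $ s $ t) (UNIV \<times> UNIV)"
        unfolding B1_def B2_def
        using power_kernel_shift_has_sum[of \<kappa>1 4 w z 1 0 s t, OF b1 wz v1]
          power_kernel_shift_has_sum[of \<kappa>2 4 w z 0 1 s t, OF b2 wz v2]
        by (simp_all only: mon of_nat_1 of_nat_0 diff_zero)
      have D: "(D has_sum (if s = t then 1 else 0)) (UNIV \<times> UNIV)"
      proof -
        have "(D has_sum (\<Sum>x\<in>{((0, 0), (0, 0))}. D x)) {((0, 0), (0, 0))}" by (intro has_sum_finite) auto
        also have "?this \<longleftrightarrow> (D has_sum (\<Sum>x\<in>{((0, 0), (0, 0))}. D x)) (UNIV \<times> UNIV)"
          by (intro has_sum_cong_neutral) (auto simp: D_def split: if_splits)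
        finally show ?thesis by (simp add: D_def monom2_def)
      qed
      have P: "(P has_sum (\<Sum>m\<in>UNIV. cnj (f w $ m $ s) * f z $ m $ t)) (UNIV \<times> UNIV)"
      proof -
        have "((\<lambda>x. cnj (case x of (k, l) \<Rightarrow> c m s k l * monom2 w (k, l))) has_sum cnj (f w $ m $ s)) UNIV" for m
          by (rule has_sum_bounded_linear[OF bounded_linear_cnj f_sum[OF wz(1)]])
        moreover have "(\<lambda>x. cmod (cnj (case x of (k, l) \<Rightarrow> c m s k l * monom2 w (k, l)))) summable_on UNIV" for m
          unfolding complex_mod_cnj using f_norm[OF wz(1), of m s] .
        ultimately have "((\<lambda>(x, y). cnj (case x of (i, j) \<Rightarrow> c m s i j * monom2 w (i, j)) *
            (case y of (k, l) \<Rightarrow> c m t k l * monom2 z (k, l)))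
          has_sum cnj (f w $ m $ s) * f z $ m $ t) (UNIV \<times> UNIV)" for m
          by (intro has_sum_product(1) f_sum[OF wz(2)] f_norm[OF wz(2)])
        from has_sum_finite_sum[OF this, where I = UNIV]
        show ?thesis
          by (rule has_sum_cong[THEN iffD1, rotated])
             (auto simp: P_def C_def sum_distrib_right sum_distrib_left mult_ac intro!: sum.cong)
      qed
      have eq: "(\<lambda>x. A1 x + A2 x) = (\<lambda>x. (B1 x + B2 x) + (D x - P x))"
      proof
        fix x :: "(nat \<times> nat) \<times> (nat \<times> nat)"
        obtain i j k l where x: "x = ((i, j), (k, l))" by (metis surj_pair)
        show "A1 x + A2 x = (B1 x + B2 x) + (D x - P x)"
          using arg_cong[OF form_coeff_identity[of "int i" "int j" s "int k" "int l" t], of "\<lambda>y. y * ?mon i j k l"]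
          unfolding x A1_def A2_def B1_def B2_def D_def P_def split \<kappa>1_def \<kappa>2_def
          by (simp add: distrib_right left_diff_distrib)
      qed
      have lhs: "((\<lambda>x. A1 x + A2 x) has_sum (?k1 w z $ s $ t + ?k2 w z $ s $ t)) (UNIV \<times> UNIV)"
        by (rule has_sum_add[OF A])
      have rhs: "((\<lambda>x. A1 x + A2 x) has_sum ((cnj (w $ 1) * z $ 1 * ?k1 w z $ s $ t + cnj (w $ 2) * z $ 2 * ?k2 w z $ s $ t) +
        ((if s = t then 1 else 0) - (\<Sum>m\<in>UNIV. cnj (f w $ m $ s) * f z $ m $ t)))) (UNIV \<times> UNIV)"
        unfolding eq by (rule has_sum_add[OF has_sum_add[OF B] has_sum_diff[OF D P]])
      from has_sum_unique[OF lhs rhs] show ?thesis by (simp add: algebra_simps)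
    qed
    show ?thesis
      unfolding vec_eq_iff
      by (simp add: entry_eq[symmetric] mat_def conj_transpose_def cscale_mat_def map_matrix_def transpose_def
          matrix_matrix_mult_def)
  qed
  with psd show ?thesis by blast
qed

end
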